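(* Let $P$ be a poset. Then $P$ is hereditarily reversible if no subset of $P$ (with the induced order) is isomorphic to any of the posets $F_i$ or $F_i^d$, $i=1,\ldots,8$.
   Context: A poset $P$ is called reversible if every order preserving bijective self map $P\to P$ is an order automorphism (i.e. its inverse is also order preserving). $P$ is called hereditarily reversible if every subposet of $P$ (subset with induced order) is reversible. Notation: $P^d$ is the dual poset of $P$; $P\sqcup Q$ is the disjoint union (no comparabilities between $P$ and $Q$); $P\oplus Q$ is the linear sum (disjoint union in which additionally every element of $P$ is below every element of $Q$). $\omega$ is the least infinite ordinal (as a chain), $D_\infty$ is the antichain of cardinality $\aleph_0$, $D_1$ is the one-element poset. The posets $F_1,\ldots,F_8$ are: - $F_1=D_\infty\sqcup\omega$; - $F_2=(D_1\oplus D_\infty)\sqcup D_\infty$; - $F_3=D_\infty\sqcup\bigsqcup_{i=0}^{\infty}(D_1\oplus D_1)$; - $F_4=D_\infty\oplus\omega$; - $F_5=(D_1\sqcup\omega^d)\oplus\omega$; - $F_6=E\oplus\omega$, where $E=\{a_i\}_{i\in\mathbb{N}}\cup\{b_i\}_{i\in\mathbb{N}}$ (all these elements distinct) is ordered so that $a_i$ and $b_i$ are incomparable for every $i$, and both $a_j$ and $b_j$ are strictly below both $a_i$ and $b_i$ whenever $j>i$ (a descending $\omega^d$-indexed linear sum of two-element antichains); - $F_7=\{c_0,c_1,c_2,\ldots\}\cup\{d_1,d_2,\ldots\}$ (all elements distinct), where $c_0<c_1<c_2<\cdots$, the $d_i$ form an antichain, no $c_j$ is below any $d_i$, and $d_i<c_j$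 if and only if $i\le j$; - $F_8=\{a_i\}_{i\in\mathbb{Z}}\cup\{b_i\}_{i\in\mathbb{Z}}$ (all elements distinct), whose only strict relations are $a_i<b_j$ for those $i,j\in\mathbb{Z}$ with $i>0$ or $j\ne i$. *)

theory Defs
  imports Main
begin

text \<open>
  A poset is a carrier set \<open>P\<close> with a relation \<open>le\<close>, of which only the values on \<open>P\<close> matter. Hence
  a subposet is a subset \<open>S \<subseteq> P\<close> with the same relation \<open>le\<close>.
\<close>

definition poset :: "'a set \<Rightarrow> ('a \<Rightarrow> 'a \<Rightarrow> bool) \<Rightarrow> bool" where
  "poset P le \<longleftrightarrow> reflp_on P le \<and> antisymp_on P le \<and> transp_on P le"

definition reversible :: "'a set \<Rightarrow> ('a \<Rightarrow> 'a \<Rightarrow> bool) \<Rightarrow> bool" where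
  "reversible P le \<longleftrightarrow>
     (\<forall>f. bij_betw f P P \<and> monotone_on P le le f \<longrightarrow> monotone_on P le le (inv_into P f))"

definition hereditarily_reversible :: "'a set \<Rightarrow> ('a \<Rightarrow> 'a \<Rightarrow> bool) \<Rightarrow> bool" where
  "hereditarily_reversible P le \<longleftrightarrow> (\<forall>S \<subseteq> P. reversible S le)"

definition isomorphic ::
    "'a set \<Rightarrow> ('a \<Rightarrow> 'a \<Rightarrow> bool) \<Rightarrow> 'b set \<Rightarrow> ('b \<Rightarrow> 'b \<Rightarrow> bool) \<Rightarrow> bool" where
  "isomorphic P le Q le' \<longleftrightarrow>
     (\<exists>f. bij_betw f P Q \<and> monotone_on P le le' f \<and> monotone_on Q le' le (inv_into P f))"

text \<open>
  The posets below live on whole types, so each is given by its (reflexive) order relation alone;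
  the dual poset is given by the converse relation.
\<close>

definition contains_copy ::
    "'a set \<Rightarrow> ('a \<Rightarrow> 'a \<Rightarrow> bool) \<Rightarrow> ('b \<Rightarrow> 'b \<Rightarrow> bool) \<Rightarrow> bool" where
  "contains_copy P le F \<longleftrightarrow> (\<exists>S \<subseteq> P. isomorphic S le (UNIV :: 'b set) F)"

fun disjoint_sum ::
    "('a \<Rightarrow> 'a \<Rightarrow> bool) \<Rightarrow> ('b \<Rightarrow> 'b \<Rightarrow> bool) \<Rightarrow> 'a + 'b \<Rightarrow> 'a + 'b \<Rightarrow> bool"
    (infixr "\<squnion>\<^sub>o" 65) where
  "(r \<squnion>\<^sub>o s) (Inl x) (Inl y) = r x y"
| "(r \<squnion>\<^sub>o s) (Inr x) (Inr y) = s x y"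
| "(r \<squnion>\<^sub>o s) (Inl x) (Inr y) = False"
| "(r \<squnion>\<^sub>o s) (Inr x) (Inl y) = False"

fun linear_sum ::
    "('a \<Rightarrow> 'a \<Rightarrow> bool) \<Rightarrow> ('b \<Rightarrow> 'b \<Rightarrow> bool) \<Rightarrow> 'a + 'b \<Rightarrow> 'a + 'b \<Rightarrow> bool"
    (infixr "\<oplus>\<^sub>o" 66) where
  "(r \<oplus>\<^sub>o s) (Inl x) (Inl y) = r x y"
| "(r \<oplus>\<^sub>o s) (Inr x) (Inr y) = s x y"
| "(r \<oplus>\<^sub>o s) (Inl x) (Inr y) = True"
| "(r \<oplus>\<^sub>o s) (Inr x) (Inl y) = False"

definition disjoint_family_sum ::
    "('i \<Rightarrow> 'a \<Rightarrow> 'a \<Rightarrow> bool) \<Rightarrow> 'i \<times> 'a \<Rightarrow> 'i \<times> 'a \<Rightarrow> bool" where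
  "disjoint_family_sum r p q \<longleftrightarrow> fst p = fst q \<and> r (fst p) (snd p) (snd q)"

definition omega :: "nat \<Rightarrow> nat \<Rightarrow> bool" where
  "omega = (\<le>)"

definition D_inf :: "nat \<Rightarrow> nat \<Rightarrow> bool" where
  "D_inf = (=)"

definition D_one :: "unit \<Rightarrow> unit \<Rightarrow> bool" where
  "D_one = (=)"

definition F1 :: "nat + nat \<Rightarrow> nat + nat \<Rightarrow> bool" where
  "F1 = D_inf \<squnion>\<^sub>o omega"

definition F2 :: "(unit + nat) + nat \<Rightarrow> (unit + nat) + nat \<Rightarrow> bool" where
  "F2 = (D_one \<oplus>\<^sub>o D_inf) \<squnion>\<^sub>o D_inf"

definition F3 :: "nat + nat \<times> (unit + unit) \<Rightarrow> nat + nat \<times> (unit + unit) \<Rightarrow> bool" where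
  "F3 = D_inf \<squnion>\<^sub>o disjoint_family_sum (\<lambda>i::nat. D_one \<oplus>\<^sub>o D_one)"

definition F4 :: "nat + nat \<Rightarrow> nat + nat \<Rightarrow> bool" where
  "F4 = D_inf \<oplus>\<^sub>o omega"

definition F5 :: "(unit + nat) + nat \<Rightarrow> (unit + nat) + nat \<Rightarrow> bool" where
  "F5 = (D_one \<squnion>\<^sub>o omega\<inverse>\<inverse>) \<oplus>\<^sub>o omega"

datatype 'i ab = a_elt (ab_index: 'i) | b_elt (ab_index: 'i)

definition E_six :: "nat ab \<Rightarrow> nat ab \<Rightarrow> bool" where
  "E_six x y \<longleftrightarrow> x = y \<or> ab_index x > ab_index y"

definition F6 :: "nat ab + nat \<Rightarrow> nat ab + nat \<Rightarrow> bool" where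
  "F6 = E_six \<oplus>\<^sub>o omega"

text \<open>The elements \<open>d\<^sub>i\<close> of the seventh poset have \<open>i \<ge> 1\<close>; here \<open>d_elt i\<close> stands for \<open>d\<^sub>i\<^sub>+\<^sub>1\<close>.\<close>

datatype cd = c_elt nat | d_elt nat

fun F7 :: "cd \<Rightarrow> cd \<Rightarrow> bool" where
  "F7 (c_elt i) (c_elt j) \<longleftrightarrow> i \<le> j"
| "F7 (d_elt i) (d_elt j) \<longleftrightarrow> i = j"
| "F7 (c_elt i) (d_elt j) \<longleftrightarrow> False"
| "F7 (d_elt i) (c_elt j) \<longleftrightarrow> Suc i \<le> j"

definition F8 :: "int ab \<Rightarrow> int ab \<Rightarrow> bool" where
  "F8 x y \<longleftrightarrow> x = y \<or> (\<exists>i j. x = a_elt i \<and> y = b_elt j \<and> (i > 0 \<or> j \<noteq> i))"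

lemma poset_UNIV_I:
  assumes "\<And>x. r x x" "\<And>x y. r x y \<Longrightarrow> r y x \<Longrightarrow> x = y" "\<And>x y z. r x y \<Longrightarrow> r y z \<Longrightarrow> r x z"
  shows "poset UNIV r"
  unfolding poset_def using assms by (blast intro: reflpI antisympI transpI)

lemma poset_UNIV_D:
  assumes "poset UNIV r"
  shows "r x x" "r x y \<Longrightarrow> r y x \<Longrightarrow> x = y" "r x y \<Longrightarrow> r y z \<Longrightarrow> r x z"
  using assms unfolding poset_def by (blast dest: reflpD antisympD transpD)+

lemma poset_disjoint_sum:
  assumes "poset UNIV r" "poset UNIV s"
  shows "poset UNIV (r \<squnion>\<^sub>o s)"
proof (rule poset_UNIV_I)
  fix x y z
  show "(r \<squnion>\<^sub>o s) x x"
    by (cases x) (simp_all add: assms[THEN poset_UNIV_D(1)])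
  show "x = y" if "(r \<squnion>\<^sub>o s) x y" "(r \<squnion>\<^sub>o s) y x"
    using that by (cases x; cases y) (simp_all, (use assms[THEN poset_UNIV_D(2)] in blast)+)
  show "(r \<squnion>\<^sub>o s) x z" if "(r \<squnion>\<^sub>o s) x y" "(r \<squnion>\<^sub>o s) y z"
    using that by (cases x; cases y; cases z) (simp_all, (use assms[THEN poset_UNIV_D(3)] in blast)+)
qed

lemma poset_linear_sum:
  assumes "poset UNIV r" "poset UNIV s"
  shows "poset UNIV (r \<oplus>\<^sub>o s)"
proof (rule poset_UNIV_I)
  fix x y z
  show "(r \<oplus>\<^sub>o s) x x"
    by (cases x) (simp_all add: assms[THEN poset_UNIV_D(1)])
  show "x = y" if "(r \<oplus>\<^sub>o s) x y" "(r \<oplus>\<^sub>o s) y x"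
    using that by (cases x; cases y) (simp_all, (use assms[THEN poset_UNIV_D(2)] in blast)+)
  show "(r \<oplus>\<^sub>o s) x z" if "(r \<oplus>\<^sub>o s) x y" "(r \<oplus>\<^sub>o s) y z"
    using that by (cases x; cases y; cases z) (simp_all, (use assms[THEN poset_UNIV_D(3)] in blast)+)
qed

lemma poset_disjoint_family_sum:
  assumes "\<And>i. poset UNIV (r i)"
  shows "poset UNIV (disjoint_family_sum r)"
proof (rule poset_UNIV_I)
  fix x y z
  show "disjoint_family_sum r x x"
    by (simp add: disjoint_family_sum_def assms[THEN poset_UNIV_D(1)])
  show "x = y" if "disjoint_family_sum r x y" "disjoint_family_sum r y x"
    using that poset_UNIV_D(2)[OF assms] unfolding disjoint_family_sum_def prod_eq_iff by metis
  show "disjoint_family_sum r x z" if "disjoint_family_sum r x y" "disjoint_family_sum r y z"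
    using that poset_UNIV_D(3)[OF assms] unfolding disjoint_family_sum_def by metis
qed

lemma poset_conversep:
  assumes "poset UNIV r"
  shows "poset UNIV (r\<inverse>\<inverse>)"
  using assms unfolding poset_def by simp

lemma poset_omega: "poset UNIV omega"
  by (rule poset_UNIV_I) (simp_all add: omega_def)

lemma poset_D_inf: "poset UNIV D_inf"
  by (rule poset_UNIV_I) (simp_all add: D_inf_def)

lemma poset_D_one: "poset UNIV D_one"
  by (rule poset_UNIV_I) (simp_all add: D_one_def)

lemma poset_E_six: "poset UNIV E_six"
  by (rule poset_UNIV_I) (auto simp: E_six_def)

lemmas poset_sums = poset_disjoint_sum poset_linear_sum poset_disjoint_family_sum poset_conversep
  poset_omega poset_D_inf poset_D_one poset_E_six

lemma poset_F1: "poset UNIV F1"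
  unfolding F1_def by (intro poset_sums)

lemma poset_F2: "poset UNIV F2"
  unfolding F2_def by (intro poset_sums)

lemma poset_F3: "poset UNIV F3"
  unfolding F3_def by (intro poset_sums)

lemma poset_F4: "poset UNIV F4"
  unfolding F4_def by (intro poset_sums)

lemma poset_F5: "poset UNIV F5"
  unfolding F5_def by (intro poset_sums)

lemma poset_F6: "poset UNIV F6"
  unfolding F6_def by (intro poset_sums)

lemma poset_F7: "poset UNIV F7"
proof (rule poset_UNIV_I)
  fix x y z
  show "F7 x x" by (cases x) simp_all
  show "x = y" if "F7 x y" "F7 y x" using that by (cases x; cases y) simp_all
  show "F7 x z" if "F7 x y" "F7 y z" using that by (cases x; cases y; cases z) simp_all
qed

lemma poset_F8: "poset UNIV F8"
  by (rule poset_UNIV_I) (auto simp: F8_def)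

end

theory Submission
  imports Defs "HOL-Library.Ramsey" "HOL-Library.Nat_Bijection"
begin

text \<open>
  Suppose that a bijection \<open>f\<close> preserves the order but its inverse does not: \<open>f a \<le> f b\<close> although
  \<open>a \<le> b\<close> fails. Put \<open>x\<^sub>n = f\<^sup>n a\<close> and \<open>y\<^sub>n = f\<^sup>n b\<close> for \<open>n \<in> \<int>\<close>. Since \<open>f\<close> can only create
  relations, \<open>x\<^sub>n \<le> y\<^sub>n\<close> holds exactly for \<open>n \<ge> 1\<close>. The forbidden copies are found inside these one
  or two orbits. Replacing \<open>f\<close> by a power passes to an arithmetic progression of indices, so a
  finite orbit may be taken to be a fixed point; both orbits cannot be finite.

  One infinite orbit (\<open>no_late_ascent\<close>, \<open>orbit_stable\<close>): if \<open>f\<close> is not an automorphism on an infinite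
  orbit, then, up to duality and a power, \<open>x\<^sub>n \<le> x\<^sub>n\<^sub>+\<^sub>1\<close> exactly for \<open>n \<ge> 1\<close>. The positive part is an
  \<open>\<omega>\<close>-chain. If some \<open>x\<^sub>n\<close> is incomparable to infinitely many earlier elements, these contain an
  antichain, which together with the \<open>\<omega>\<close>-chain gives \<open>F\<^sub>1\<close>, \<open>F\<^sub>4\<close> or \<open>F\<^sub>7\<close>
  (\<open>antichain_below_chain\<close>), or a descending chain, which gives \<open>F\<^sub>5\<close>. Otherwise each element lies
  above all but finitely many earlier ones, and the incomparable pairs \<open>x\<^sub>n, x\<^sub>n\<^sub>+\<^sub>1\<close> with \<open>n \<le> 0\<close>
  can be thinned out to a copy of \<open>F\<^sub>6\<close>. Hence \<open>f\<close> is an automorphism on every infinite orbit, and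
  after passing to a power the orbit is an antichain, an increasing or a decreasing \<open>\<int>\<close>-chain
  (\<open>orbit_types\<close>).

  A fixed point and an infinite orbit, where duality allows the fixed point to be \<open>a\<close>
  (\<open>orbit_over_point\<close>), give \<open>F\<^sub>2\<close> when the orbit is an antichain and \<open>F\<^sub>5\<close> when it is an increasing chain; a decreasing chain is contradictory.

  Two infinite orbits (\<open>typed_orbits\<close>) leave nine combinations of types, which duality reduces to
  six. The main one is that of two antichains (\<open>antichain_antichain\<close>). Avoiding \<open>F\<^sub>2\<close> and its dual
  makes every \<open>x\<^sub>i\<close> comparable to finitely many or to all but finitely many \<open>y\<^sub>j\<close>, and conversely. As
  \<open>f\<close> creates relations along the diagonals \<open>j - i\<close> only in the forward direction, the same
  alternative holds for all elements. In the finite case one thins out to \<open>F\<^sub>3\<close>, in the cofinite case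
  to \<open>F\<^sub>8\<close>.
\<close>

section \<open>Copies of posets and duality\<close>

lemma contains_copyI:
  assumes P: "poset P le" and F: "poset UNIV F"
    and g: "\<And>u. g u \<in> P" "\<And>u v. le (g u) (g v) \<longleftrightarrow> F u v"
  shows "contains_copy P le F"
proof -
  have refl: "le (g u) (g u)" for u
    using poset_UNIV_D(1)[OF F] g(2) by blast
  have inj: "inj g"
    using refl g(2) poset_UNIV_D(2)[OF F] by (metis injI)
  have inv_g: "inv_into (range g) (inv g) u = g u" for u
    by (rule inv_into_f_eq) (use inj in \<open>auto intro: inj_on_inv_into\<close>)
  have "isomorphic (range g) le UNIV F"
    unfolding isomorphic_def
  proof (intro exI conjI)
    show "bij_betw (inv g) (range g) UNIV"
      using inj by (simp add: bij_betw_inv_into bij_betw_imageI)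
    show "monotone_on (range g) le F (inv g)"
      by (auto simp: monotone_on_def inj g(2))
    show "monotone_on UNIV F le (inv_into (range g) (inv g))"
      by (simp add: monotone_on_def inv_g g(2))
  qed
  then show ?thesis
    unfolding contains_copy_def using g(1) by blast
qed

lemma contains_copy_dual: "contains_copy P le\<inverse>\<inverse> F\<inverse>\<inverse> \<longleftrightarrow> contains_copy P le F"
  unfolding contains_copy_def isomorphic_def monotone_on_def by simp blast

lemma contains_copy_mono: "contains_copy S le F \<Longrightarrow> S \<subseteq> P \<Longrightarrow> contains_copy P le F"
  unfolding contains_copy_def by blast

text \<open>
  The sixteen forbidden posets come in dual pairs. Excluding both members of a pair at once makes the
  hypothesis invariant under reversing the order, so that every lemma below is also available for the
  dual order.
\<close>

definition omits :: "'a set \<Rightarrow> ('a \<Rightarrow> 'a \<Rightarrow> bool) \<Rightarrow> ('b \<Rightarrow> 'b \<Rightarrow> bool) \<Rightarrow> bool" where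
  "omits P le F \<longleftrightarrow> \<not> contains_copy P le F \<and> \<not> contains_copy P le F\<inverse>\<inverse>"

lemma omits_dual: "omits P le\<inverse>\<inverse> F \<longleftrightarrow> omits P le F"
  using contains_copy_dual[of P le F] contains_copy_dual[of P le "F\<inverse>\<inverse>"]
  by (auto simp: omits_def)

lemma omits_subset: "omits P le F \<Longrightarrow> S \<subseteq> P \<Longrightarrow> omits S le F"
  using contains_copy_mono unfolding omits_def by blast

locale copy_free =
  fixes P :: "'a set" and le :: "'a \<Rightarrow> 'a \<Rightarrow> bool"
  assumes poset: "poset P le"
    and no_copy: "omits P le F1" "omits P le F2" "omits P le F3" "omits P le F4"
      "omits P le F5" "omits P le F6" "omits P le F7" "omits P le F8"

lemma copy_free_dual: "copy_free P le \<Longrightarrow> copy_free P le\<inverse>\<inverse>"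
  unfolding copy_free_def by (simp add: poset_def omits_dual)

lemma copy_free_subset:
  assumes "copy_free P le" and S: "S \<subseteq> P"
  shows "copy_free S le"
proof -
  have "poset S le"
    using assms unfolding copy_free_def poset_def
    by (meson S reflp_on_subset antisymp_on_subset transp_on_subset)
  then show ?thesis
    using assms by (simp add: copy_free_def omits_subset[OF _ S])
qed

context copy_free
begin

lemma refl: "u \<in> P \<Longrightarrow> le u u"
  using poset unfolding poset_def by (blast dest: reflp_onD)

lemma antisym: "le u v \<Longrightarrow> le v u \<Longrightarrow> u \<in> P \<Longrightarrow> v \<in> P \<Longrightarrow> u = v"
  using poset unfolding poset_def by (blast dest: antisymp_onD)

lemma trans: "le u v \<Longrightarrow> le v w \<Longrightarrow> u \<in> P \<Longrightarrow> v \<in> P \<Longrightarrow> w \<in> P \<Longrightarrow> le u w"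
  using poset unfolding poset_def by (blast dest: transp_onD)

end

section \<open>The forbidden posets as sequences\<close>

text \<open>
  Each of the next lemmas spells out a copy of one forbidden poset through the sequences of which it
  consists. For \<open>F\<^sub>5\<close> and \<open>F\<^sub>6\<close> it is enough to know the relations at the places where the pieces
  meet; the others follow by transitivity.
\<close>

context copy_free
begin

lemma no_F1:
  fixes d c :: "nat \<Rightarrow> 'a"
  assumes "\<And>i. d i \<in> P" "\<And>i. c i \<in> P"
    and "\<And>i j. le (d i) (d j) \<longleftrightarrow> i = j" "\<And>i j. le (c i) (c j) \<longleftrightarrow> i \<le> j"
    and "\<And>i j. \<not> le (d i) (c j)" "\<And>i j. \<not> le (c j) (d i)"
  shows False
proof -
  have "contains_copy P le F1"
  proof (rule contains_copyI[OF poset poset_F1])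
    show "case_sum d c u \<in> P" for u
      using assms by (cases u) auto
    show "le (case_sum d c u) (case_sum d c v) \<longleftrightarrow> F1 u v" for u v
      using assms by (cases u; cases v) (auto simp: F1_def D_inf_def omega_def)
  qed
  then show False using no_copy by (simp add: omits_def)
qed

lemma no_F2:
  fixes b c :: "nat \<Rightarrow> 'a"
  assumes "p \<in> P" "\<And>i. b i \<in> P" "\<And>i. c i \<in> P"
    and "\<And>i j. le (b i) (b j) \<longleftrightarrow> i = j" "\<And>i j. le (c i) (c j) \<longleftrightarrow> i = j"
    and "\<And>i j. \<not> le (b i) (c j)" "\<And>i j. \<not> le (c i) (b j)"
    and "\<And>i. le p (b i)" "\<And>i. \<not> le (b i) p"
    and "\<And>i. \<not> le p (c i)" "\<And>i. \<not> le (c i) p"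
  shows False
proof -
  let ?g = "case_sum (case_sum (\<lambda>_. p) b) c"
  have "contains_copy P le F2"
  proof (rule contains_copyI[OF poset poset_F2])
    show "?g u \<in> P" for u
      using assms by (auto split: sum.split)
    have "\<forall>u v. le (?g u) (?g v) \<longleftrightarrow> F2 u v"
      unfolding split_sum_all using assms refl by (simp add: F2_def D_inf_def D_one_def)
    then show "le (?g u) (?g v) \<longleftrightarrow> F2 u v" for u v by blast
  qed
  then show False using no_copy by (simp add: omits_def)
qed

lemma no_F3:
  fixes d u v :: "nat \<Rightarrow> 'a"
  assumes "\<And>i. d i \<in> P" "\<And>i. u i \<in> P" "\<And>i. v i \<in> P"
    and "\<And>i j. le (d i) (d j) \<longleftrightarrow> i = j"
    and "\<And>i j. le (u i) (u j) \<longleftrightarrow> i = j" "\<And>i j. le (v i) (v j) \<longleftrightarrow> i = j"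
    and "\<And>i j. le (u i) (v j) \<longleftrightarrow> i = j" "\<And>i j. \<not> le (v i) (u j)"
    and "\<And>i j. \<not> le (d i) (u j)" "\<And>i j. \<not> le (d i) (v j)"
    and "\<And>i j. \<not> le (u i) (d j)" "\<And>i j. \<not> le (v i) (d j)"
  shows False
proof -
  let ?g = "case_sum d (\<lambda>(i, s). case_sum (\<lambda>_::unit. u i) (\<lambda>_::unit. v i) s)"
  have "contains_copy P le F3"
  proof (rule contains_copyI[OF poset poset_F3])
    show "?g s \<in> P" for s
      using assms by (auto split: sum.split)
    have "\<forall>s t. le (?g s) (?g t) \<longleftrightarrow> F3 s t"
      unfolding split_sum_all split_paired_All using assms
      by (simp add: F3_def D_inf_def D_one_def disjoint_family_sum_def)
    then show "le (?g s) (?g t) \<longleftrightarrow> F3 s t" for s t by blast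
  qed
  then show False using no_copy by (simp add: omits_def)
qed

lemma no_F4:
  fixes d c :: "nat \<Rightarrow> 'a"
  assumes "\<And>i. d i \<in> P" "\<And>i. c i \<in> P"
    and "\<And>i j. le (d i) (d j) \<longleftrightarrow> i = j" "\<And>i j. le (c i) (c j) \<longleftrightarrow> i \<le> j"
    and "\<And>i j. le (d i) (c j)" "\<And>i j. \<not> le (c j) (d i)"
  shows False
proof -
  have "contains_copy P le F4"
  proof (rule contains_copyI[OF poset poset_F4])
    show "case_sum d c u \<in> P" for u
      using assms by (cases u) auto
    show "le (case_sum d c u) (case_sum d c v) \<longleftrightarrow> F4 u v" for u v
      using assms by (cases u; cases v) (auto simp: F4_def D_inf_def omega_def)
  qed
  then show False using no_copy by (simp add: omits_def)
qed

lemma no_F5: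
  fixes e c :: "nat \<Rightarrow> 'a"
  assumes P: "p \<in> P" "\<And>i. e i \<in> P" "\<And>i. c i \<in> P"
    and e: "\<And>i j. le (e i) (e j) \<longleftrightarrow> j \<le> i" and c: "\<And>i j. le (c i) (c j) \<longleftrightarrow> i \<le> j"
    and pe: "\<And>i. \<not> le p (e i)" "\<And>i. \<not> le (e i) p"
    and top: "le p (c 0)" "le (e 0) (c 0)"
  shows False
proof -
  have pc: "le p (c i)" for i
    using trans[OF top(1)] c P by blast
  have ec: "le (e i) (c j)" for i j
    using trans[of "e i" "e 0" "c j"] trans[OF top(2), of "c j"] e c P by simp
  have cp: "\<not> le (c i) p" for i
    using trans[OF ec[of 0 i]] pe P by blast
  have ce: "\<not> le (c i) (e j)" for i j
    using trans[OF pc[of i]] pe P by blast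
  let ?g = "case_sum (case_sum (\<lambda>_. p) e) c"
  have "contains_copy P le F5"
  proof (rule contains_copyI[OF poset poset_F5])
    show "?g u \<in> P" for u
      using P by (auto split: sum.split)
    have "\<forall>u v. le (?g u) (?g v) \<longleftrightarrow> F5 u v"
      unfolding split_sum_all using refl P e c pe pc ec cp ce
      by (simp add: F5_def omega_def D_one_def)
    then show "le (?g u) (?g v) \<longleftrightarrow> F5 u v" for u v by blast
  qed
  then show False using no_copy by (simp add: omits_def)
qed

lemma no_F6:
  fixes u v c :: "nat \<Rightarrow> 'a"
  assumes P: "\<And>i. u i \<in> P" "\<And>i. v i \<in> P" "\<And>i. c i \<in> P"
    and c: "\<And>i j. le (c i) (c j) \<longleftrightarrow> i \<le> j"
    and uv: "\<And>i. \<not> le (u i) (v i)" "\<And>i. \<not> le (v i) (u i)"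
    and down: "\<And>i j. i < j \<Longrightarrow> le (u j) (u i) \<and> le (u j) (v i) \<and> le (v j) (u i) \<and> le (v j) (v i)"
    and top: "le (u 0) (c 0)" "le (v 0) (c 0)"
  shows False
proof -
  let ?g = "case_sum (case_ab u v) c"
  have up: "\<not> le (u i) (u j)" "\<not> le (u i) (v j)" "\<not> le (v i) (u j)" "\<not> le (v i) (v j)" if "i < j" for i j
    using that down[OF that] uv[of i] trans[of "u i"] trans[of "v i"] P by meson+
  have topu: "le (u i) (c j)" for i j
    using trans[OF top(1), of "c j"] trans[of "u i" "u 0" "c j"] down[of 0 i] c P by (cases i) auto
  have topv: "le (v i) (c j)" for i j
    using trans[OF top(2), of "c j"] trans[of "v i" "v 0" "c j"] down[of 0 i] c P by (cases i) auto
  have cu: "\<not> le (c i) (u j)" for i j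
    using trans[OF topv[of j i]] uv P by blast
  have cv: "\<not> le (c i) (v j)" for i j
    using trans[OF topu[of j i]] uv P by blast
  have "contains_copy P le F6"
  proof (rule contains_copyI[OF poset poset_F6])
    show "?g s \<in> P" for s
      using P by (auto split: sum.split ab.split)
    have "le (case_ab u v s) (case_ab u v t) \<longleftrightarrow> E_six s t" for s t
      using refl P uv down up
      by (cases s; cases t; cases "ab_index s" "ab_index t" rule: linorder_cases)
        (auto simp: E_six_def)
    then show "le (?g s) (?g t) \<longleftrightarrow> F6 s t" for s t
      using topu topv cu cv c
      by (cases s; cases t) (auto simp: F6_def omega_def split: ab.split)
  qed
  then show False using no_copy by (simp add: omits_def)
qed

lemma no_F7:
  fixes d c :: "nat \<Rightarrow> 'a"
  assumes "\<And>i. d i \<in> P" "\<And>i. c i \<in> P"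
    and "\<And>i j. le (d i) (d j) \<longleftrightarrow> i = j" "\<And>i j. le (c i) (c j) \<longleftrightarrow> i \<le> j"
    and "\<And>i j. le (d i) (c j) \<longleftrightarrow> Suc i \<le> j" "\<And>i j. \<not> le (c j) (d i)"
  shows False
proof -
  have "contains_copy P le F7"
  proof (rule contains_copyI[OF poset poset_F7])
    show "case_cd c d u \<in> P" for u
      using assms by (cases u) auto
    show "le (case_cd c d u) (case_cd c d v) \<longleftrightarrow> F7 u v" for u v
      using assms by (cases u; cases v) auto
  qed
  then show False using no_copy by (simp add: omits_def)
qed

lemma no_F8:
  fixes x y :: "int \<Rightarrow> 'a"
  assumes "\<And>i. x i \<in> P" "\<And>i. y i \<in> P"
    and "\<And>i j. le (x i) (x j) \<longleftrightarrow> i = j" "\<And>i j. le (y i) (y j) \<longleftrightarrow> i = j"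
    and "\<And>i j. le (x i) (y j) \<longleftrightarrow> i > 0 \<or> j \<noteq> i" "\<And>i j. \<not> le (y i) (x j)"
  shows False
proof -
  have "contains_copy P le F8"
  proof (rule contains_copyI[OF poset poset_F8])
    show "case_ab x y u \<in> P" for u
      using assms by (cases u) auto
    show "le (case_ab x y u) (case_ab x y v) \<longleftrightarrow> F8 u v" for u v
      using assms by (cases u; cases v) (auto simp: F8_def)
  qed
  then show False using no_copy by (simp add: omits_def)
qed

end


section \<open>Thinning sequences\<close>

text \<open>
  The greedy choice of a subsequence: the \<open>j\<close>-th index is taken beyond the thresholds of all earlier
  indices. This replaces Ramsey's theorem wherever a relation is already known to hold eventually.
\<close>

lemma thin_sequence:
  fixes R :: "nat \<Rightarrow> nat \<Rightarrow> bool"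
  assumes "\<And>k. \<exists>K. \<forall>m\<ge>K. R k m"
  shows "\<exists>r :: nat \<Rightarrow> nat. strict_mono r \<and> (\<forall>i j. i < j \<longrightarrow> R (r i) (r j))"
proof -
  obtain K where K: "\<And>k m. m \<ge> K k \<Longrightarrow> R k m"
    using assms by metis
  define r where "r = rec_nat 0 (\<lambda>_ k. Suc (k + (\<Sum>l\<le>k. K l)))"
  have r_Suc: "r (Suc n) = Suc (r n + (\<Sum>l\<le>r n. K l))" for n
    by (simp add: r_def)
  have mono: "strict_mono r"
    by (simp add: strict_mono_Suc_iff r_Suc less_Suc_eq_le)
  have "R (r i) (r j)" if "i < j" for i j
  proof -
    from less_imp_Suc_add[OF that] obtain j' where j: "j = Suc j'" "i \<le> j'"
      by auto
    have "r i \<le> r j'"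
      using mono j(2) by (simp add: strict_mono_less_eq)
    then have "K (r i) \<le> (\<Sum>l\<le>r j'. K l)"
      by (intro member_le_sum) auto
    then show ?thesis
      using K j(1) r_Suc by simp
  qed
  then show ?thesis
    using mono by blast
qed

lemma finite_int_bounded:
  fixes A :: "int set"
  assumes "finite A"
  shows "\<exists>B. \<forall>q\<in>A. \<bar>q\<bar> < B"
proof (intro exI ballI)
  show "\<bar>q\<bar> < Max (insert 0 (abs ` A)) + 1" if "q \<in> A" for q
    using assms that by (simp add: less_Suc_eq_le zle_add1_eq_le)
qed

lemma one_le_mult_iff:
  fixes N n :: int
  assumes "N > 0"
  shows "1 \<le> N * n \<longleftrightarrow> 1 \<le> n"
  using assms by (simp add: int_one_le_iff_zero_less zero_less_mult_iff)

lemma finite_nat_eventually: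
  fixes Q :: "nat \<Rightarrow> bool"
  assumes "finite {k. \<not> Q k}"
  shows "\<exists>K. \<forall>k\<ge>K. Q k"
  using assms unfolding finite_nat_set_iff_bounded by (metis mem_Collect_eq not_less)

section \<open>Forbidden configurations\<close>

context copy_free
begin

text \<open>
  Each \<open>d\<^sub>i\<close> is below no \<open>c\<^sub>j\<close>, or below all from a first height \<open>h i\<close> on. If infinitely many
  elements have no height, they form \<open>F\<^sub>1\<close> with the chain; if infinitely many have bounded height, they
  form \<open>F\<^sub>4\<close> with a tail of the chain. Otherwise a subsequence has strictly increasing heights, and the
  chain elements at these heights complete it to \<open>F\<^sub>7\<close>.
\<close>

lemma antichain_below_chain:
  fixes d c :: "nat \<Rightarrow> 'a"
  assumes P: "\<And>i. d i \<in> P" "\<And>i. c i \<in> P"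
    and d: "\<And>i j. le (d i) (d j) \<longleftrightarrow> i = j" and c: "\<And>i j. le (c i) (c j) \<longleftrightarrow> i \<le> j"
    and cd: "\<And>i j. \<not> le (c j) (d i)"
  shows False
proof -
  have sub: "le (d (r i)) (d (r j)) \<longleftrightarrow> i = j" if "strict_mono r" for r :: "nat \<Rightarrow> nat" and i j
    by (simp add: d strict_mono_eq[OF that])
  have up: "le (d i) (c k)" if "le (d i) (c j)" "j \<le> k" for i j k
    using that trans c P by blast
  have fin1: "finite {i. \<not> (\<exists>j. le (d i) (c j))}"
  proof (rule ccontr)
    assume "\<not> ?thesis"
    from infinite_enumerate[OF this] obtain r :: "nat \<Rightarrow> nat"
      where r: "strict_mono r" "\<forall>i. r i \<in> {i. \<not> (\<exists>j. le (d i) (c j))}" by (elim exE conjE)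
    show False
      by (rule no_F1[of "\<lambda>i. d (r i)" c]) (use P sub[OF r(1)] r(2) c cd in auto)
  qed
  have fin2: "finite {i. le (d i) (c j)}" for j
  proof (rule ccontr)
    assume "\<not> ?thesis"
    from infinite_enumerate[OF this] obtain r :: "nat \<Rightarrow> nat"
      where r: "strict_mono r" "\<forall>i. r i \<in> {i. le (d i) (c j)}" by (elim exE conjE)
    show False
      by (rule no_F4[of "\<lambda>i. d (r i)" "\<lambda>i. c (j + i)"]) (use P sub[OF r(1)] r(2) c cd up[of _ j] in auto)
  qed
  obtain N where N: "\<And>i. i \<ge> N \<Longrightarrow> \<exists>j. le (d i) (c j)"
    using finite_nat_eventually[OF fin1] by auto
  define h where "h i = (LEAST j. le (d i) (c j))" for i
  have h: "le (d i) (c j) \<longleftrightarrow> h i \<le> j" if "i \<ge> N" for i j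
    using N[OF that] up[of i "h i" j] unfolding h_def by (metis LeastI_ex Least_le)
  have "\<exists>K. \<forall>m\<ge>K. m \<ge> N \<longrightarrow> h k < h m" for k
  proof -
    have "\<exists>K. \<forall>m\<ge>K. \<not> le (d m) (c (h k))"
      using fin2[of "h k"] by (intro finite_nat_eventually) simp
    then show ?thesis
      using h by (meson not_less)
  qed
  from thin_sequence[of "\<lambda>k m. m \<ge> N \<longrightarrow> h k < h m", OF this] obtain r :: "nat \<Rightarrow> nat"
    where r: "strict_mono r" "\<forall>i j. i < j \<longrightarrow> r j \<ge> N \<longrightarrow> h (r i) < h (r j)"
    by (elim exE conjE)
  \<comment> \<open>Skipping \<open>N\<close> terms ensures that the index is at least \<open>N\<close>, where the height exists.\<close>
  define s where "s i = r (N + i)" for i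
  have sN: "s i \<ge> N" for i
    unfolding s_def using strict_mono_imp_increasing[OF r(1), of "N + i"] by simp
  have s: "strict_mono s"
    using r(1) by (simp add: s_def strict_mono_def)
  have "strict_mono (\<lambda>i. h (s i))"
    using r(2) sN by (simp add: s_def strict_mono_def)
  then have hs: "h (s i) \<le> h (s j) \<longleftrightarrow> i \<le> j" for i j
    by (rule strict_mono_less_eq)
  \<comment> \<open>The shift of the antichain by one keeps all its members from lying below the least chain element,
    as required for \<open>c\<^sub>0\<close> in \<open>F\<^sub>7\<close>.\<close>
  show False
    by (rule no_F7[of "\<lambda>i. d (s (Suc i))" "\<lambda>j. c (h (s j))"])
      (use P c cd s h[OF sN] hs sub[OF s] in auto)
qed

text \<open>
  Infinitely many elements of the antichain above \<open>p\<close> and infinitely many others would form \<open>F\<^sub>2\<close>. The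
  index set \<open>\<int>\<close> is the one in which orbits are given.
\<close>

lemma antichain_split_below:
  fixes y :: "int \<Rightarrow> 'a"
  assumes P: "p \<in> P" "\<And>i. y i \<in> P"
    and y: "\<And>i j. le (y i) (y j) \<longleftrightarrow> i = j" and py: "\<And>i. \<not> le (y i) p"
    and inf: "infinite {i. le p (y i)}"
  shows "finite {i. \<not> le p (y i)}"
proof (rule ccontr)
  assume inf': "infinite {i. \<not> le p (y i)}"
  obtain b :: "nat \<Rightarrow> int" where b: "inj b" "\<And>i. le p (y (b i))"
    using infinite_countable_subset[OF inf] by auto
  obtain c :: "nat \<Rightarrow> int" where c: "inj c" "\<And>i. \<not> le p (y (c i))"
    using infinite_countable_subset[OF inf'] by auto
  have bc: "b i \<noteq> c j" for i j
    using b(2) c(2) by metis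
  show False
    by (rule no_F2[of p "\<lambda>i. y (b i)" "\<lambda>i. y (c i)"])
      (use P y py b c bc bc[symmetric] in \<open>auto simp: inj_eq\<close>)
qed

text \<open>
  Thinning out two descending sequences that dominate each other's tails gives the two-element
  antichains of \<open>F\<^sub>6\<close>, one below the other.
\<close>

lemma parallel_descents:
  fixes u v c :: "nat \<Rightarrow> 'a"
  assumes P: "\<And>i. u i \<in> P" "\<And>i. v i \<in> P" "\<And>i. c i \<in> P"
    and c: "\<And>i j. le (c i) (c j) \<longleftrightarrow> i \<le> j"
    and uv: "\<And>i. \<not> le (u i) (v i)" "\<And>i. \<not> le (v i) (u i)"
    and down: "\<And>k. \<exists>K. \<forall>m\<ge>K. le (u m) (u k) \<and> le (u m) (v k) \<and> le (v m) (u k) \<and> le (v m) (v k)"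
    and top: "\<exists>K. \<forall>k\<ge>K. le (u k) (c 0) \<and> le (v k) (c 0)"
  shows False
proof -
  obtain K where K: "\<And>k. k \<ge> K \<Longrightarrow> le (u k) (c 0) \<and> le (v k) (c 0)"
    using top by blast
  from thin_sequence[of "\<lambda>k m. le (u m) (u k) \<and> le (u m) (v k) \<and> le (v m) (u k) \<and> le (v m) (v k)",
      OF down] obtain r :: "nat \<Rightarrow> nat" where r: "strict_mono r"
    "\<forall>i j. i < j \<longrightarrow> le (u (r j)) (u (r i)) \<and> le (u (r j)) (v (r i)) \<and>
       le (v (r j)) (u (r i)) \<and> le (v (r j)) (v (r i))"
    by (elim exE conjE)
  have rK: "r K \<ge> K"
    using strict_mono_imp_increasing[OF r(1)] .
  show False
    by (rule no_F6[of "\<lambda>i. u (r (K + i))" "\<lambda>i. v (r (K + i))" c])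
      (use P c uv r(2) K[OF rK] in auto)
qed

end

text \<open>
  What remains of an order preserving map \<open>f\<close> once its orbits are parametrised by \<open>\<int>\<close>: a relation
  between \<open>x i\<close> and \<open>y j\<close> persists when both indices move forward. This property passes to powers
  of \<open>f\<close> and, with \<open>x\<close> and \<open>y\<close> exchanged, to the dual order.
\<close>

definition shifts :: "('a \<Rightarrow> 'a \<Rightarrow> bool) \<Rightarrow> (int \<Rightarrow> 'a) \<Rightarrow> (int \<Rightarrow> 'a) \<Rightarrow> bool" where
  "shifts le x y \<longleftrightarrow> (\<forall>i j k. 0 \<le> k \<longrightarrow> le (x i) (y j) \<longrightarrow> le (x (i + k)) (y (j + k)))"

lemma shiftsD: "shifts le x y \<Longrightarrow> le (x i) (y j) \<Longrightarrow> 0 \<le> k \<Longrightarrow> le (x (i + k)) (y (j + k))"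
  unfolding shifts_def by blast

lemma shifts_dual: "shifts le\<inverse>\<inverse> x y \<longleftrightarrow> shifts le y x"
  unfolding shifts_def by auto

lemma shifts_power: "shifts le x y \<Longrightarrow> 0 \<le> N \<Longrightarrow> shifts le (\<lambda>n. x (i + N * n)) (\<lambda>n. y (j + N * n))"
  unfolding shifts_def by (simp add: distrib_left add.assoc[symmetric])

section \<open>One orbit\<close>

context copy_free
begin

text \<open>
  The impossible shape of a single orbit: an \<open>\<omega>\<close>-chain preceded by elements whose neighbours in the
  orbit are incomparable to them. A relation \<open>x j \<le> x i\<close> with \<open>i < j\<close> would be shifted into the
  increasing part, so only ascending relations occur. The central claim is that each \<open>x n\<close> with
  \<open>n \<le> 1\<close> lies above all but finitely many earlier elements, as otherwise Ramsey's theorem provides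
  an antichain or a descending chain among those that it does not dominate.
\<close>

lemma no_late_ascent:
  fixes x :: "int \<Rightarrow> 'a"
  assumes P: "\<And>i. x i \<in> P" and inj: "inj x" and sh: "shifts le x x"
    and late: "\<And>n. le (x n) (x (n + 1)) \<longleftrightarrow> 1 \<le> n"
  shows False
proof -
  have up: "le (x i) (x j)" if "1 \<le> i" "i \<le> j" for i j
    using that(2)
  proof (induction j rule: int_ge_induct)
    case base
    show ?case using refl P .
  next
    case (step j)
    then show ?case using late[of j] trans[OF step.IH] P that(1) by simp
  qed
  have eq: "i = j" if "x i = x j" for i j
    using inj that by (simp add: inj_eq)
  have nodown: "\<not> le (x j) (x i)" if "i < j" for i j
  proof
    assume "le (x j) (x i)"
    define k where "k = max 0 (1 - i)"
    have "le (x (j + k)) (x (i + k))"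
      using shiftsD[OF sh \<open>le (x j) (x i)\<close>] by (simp add: k_def)
    moreover have "le (x (i + k)) (x (j + k))"
      using up that by (simp add: k_def)
    ultimately show False
      using antisym P eq[of "i + k" "j + k"] that by force
  qed
  have chain: "le (x (1 + J + int i)) (x (1 + J + int j)) \<longleftrightarrow> i \<le> j" if "J \<ge> 0" for J i j
    using up[of "1 + J + int i" "1 + J + int j"] nodown[of "1 + J + int j" "1 + J + int i"] that
    by (cases "i \<le> j") auto
  have cofinal: "finite {k. \<not> le (x (n - int k)) (x n)}" if n: "n \<le> 1" for n
  proof (rule ccontr)
    define Z where "Z = {k. \<not> le (x (n - int k)) (x n)}"
    assume "infinite {k. \<not> le (x (n - int k)) (x n)}"
    then have "infinite Z" by (simp add: Z_def)
    define col where "col S = (if le (x (n - int (Max S))) (x (n - int (Min S))) then 1 else 0::nat)"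
      for S
    have "\<forall>a\<in>Z. \<forall>b\<in>Z. a \<noteq> b \<longrightarrow> col {a, b} < 2"
      by (simp add: col_def)
    from Ramsey2[OF \<open>infinite Z\<close> this] obtain Y t
      where "Y \<subseteq> Z \<and> infinite Y \<and> t < 2 \<and> (\<forall>a\<in>Y. \<forall>b\<in>Y. a \<noteq> b \<longrightarrow> col {a, b} = t)"
      by (elim exE)
    then have Y: "Y \<subseteq> Z" "infinite Y"
      and t: "\<And>a b. a \<in> Y \<Longrightarrow> b \<in> Y \<Longrightarrow> a \<noteq> b \<Longrightarrow> col {a, b} = t" by simp_all
    from infinite_enumerate[OF Y(2)] obtain r :: "nat \<Rightarrow> nat"
      where r: "strict_mono r" "\<forall>i. r i \<in> Y" by (elim exE conjE)
    have less: "r i < r j \<longleftrightarrow> i < j" for i j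
      using r(1) by (rule strict_mono_less)
    have nodown': "\<not> le (x (n - int (r i))) (x (n - int (r j)))" if "i < j" for i j
      using that less by (intro nodown) simp
    have col: "t = (if le (x (n - int (r j))) (x (n - int (r i))) then 1 else 0)" if "i < j" for i j
      using t[of "r i" "r j"] r(2) that less[of i j] by (simp add: col_def split: if_splits)
    have rZ: "\<not> le (x (n - int (r i))) (x n)" for i
      using r(2) Y(1) by (auto simp: Z_def)
    have rpos: "r i > 0" for i
      using rZ[of i] refl[OF P] by (cases "r i") auto
    show False
    proof (cases "t = 0")
      case True
      show False
      proof (rule antichain_below_chain[of "\<lambda>i. x (n - int (r i))" "\<lambda>j. x (1 + 0 + int j)"])
        show "le (x (n - int (r i))) (x (n - int (r j))) \<longleftrightarrow> i = j" for i j
          using col[of j i] True nodown'[of i j] refl P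
          by (cases i j rule: linorder_cases) (auto split: if_splits)
        show "\<not> le (x (1 + 0 + int j)) (x (n - int (r i)))" for i j
          using n rpos[of i] by (intro nodown) simp
      qed (use P chain[of 0] in auto)
    next
      case False
      have e: "le (x (n - int (r i))) (x (n - int (r j))) \<longleftrightarrow> j \<le> i" for i j
        using col[of j i] False nodown'[of i j] refl P
        by (cases i j rule: linorder_cases) (auto split: if_splits)
      define a k where "a = n - int (r 1)" and "k = int (r 1) - int (r 0)"
      have k: "k > 0" using less[of 0 1] by (simp add: k_def)
      have "le (x a) (x (a + k))"
        using e[of 1 0] by (simp add: a_def k_def)
      then have step: "le (x (a + s)) (x (a + s + k))" if "s \<ge> 0" for s
        using shiftsD[OF sh, of a "a + k" s] that by (simp add: ac_simps)
      \<comment> \<open>One relation inside the descending chain, shifted repeatedly, carries every later element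
        into the \<open>\<omega>\<close>-chain. This yields the common upper bounds needed for \<open>F\<^sub>5\<close>.\<close>
      have climb: "le (x (a + s)) (x (a + s + k * int m))" if "s \<ge> 0" for s m
      proof (induction m)
        case 0
        show ?case using refl P by simp
      next
        case (Suc m)
        then show ?case
          using step[of "s + k * int m"] trans[OF Suc] P that k by (simp add: algebra_simps)
      qed
      have reach: "\<exists>J\<ge>1. le (x (a + s)) (x J)" if "s \<ge> 0" for s
      proof -
        have "nat (1 - a) * 1 \<le> nat (1 - a) * nat k"
          using k by (intro mult_le_mono2) simp
        then have "1 - a \<le> k * int (nat (1 - a))"
          using k by (smt (verit, ccfv_threshold) int_nat_eq mult_le_cancel_right1 mult_nonneg_nonneg)
        then show ?thesis
          using climb[OF that, of "nat (1 - a)"] that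
          by (intro exI[of _ "a + s + k * int (nat (1 - a))"]) simp
      qed
      obtain J where J: "J \<ge> 1" "le (x n) (x J)"
        using reach[of "int (r 1)"] by (auto simp: a_def)
      obtain J' where J': "J' \<ge> 1" "le (x (n - int (r 0))) (x J')"
        using reach[of k] k by (auto simp: a_def k_def)
      define M where "M = max J J' - 1"
      show False
      proof (rule no_F5[of "x n" "\<lambda>i. x (n - int (r i))" "\<lambda>j. x (1 + M + int j)"])
        show "\<not> le (x n) (x (n - int (r i)))" for i
          using rpos by (intro nodown) simp
        show "le (x n) (x (1 + M + int 0))"
          using trans[OF J(2) up[OF J(1)]] P by (simp add: M_def)
        show "le (x (n - int (r 0))) (x (1 + M + int 0))"
          using trans[OF J'(2) up[OF J'(1)]] P by (simp add: M_def)
      qed (use P e rZ chain[of M] J in \<open>auto simp: M_def\<close>)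
    qed
  qed
  have ev: "\<exists>K. \<forall>m\<ge>K. le (x (- int m)) (x n) \<and> le (x (1 - int m)) (x n)" if n: "n \<le> 1" for n
  proof -
    obtain K where K: "\<And>k. k \<ge> K \<Longrightarrow> le (x (n - int k)) (x n)"
      using finite_nat_eventually[OF cofinal[OF n]] by blast
    have "le (x l) (x n)" if "l \<le> n - int K" for l
    proof -
      have "0 \<le> n - l" using that by linarith
      then show ?thesis using K[of "nat (n - l)"] that by (simp add: le_nat_iff)
    qed
    then have "le (x (- int m)) (x n) \<and> le (x (1 - int m)) (x n)" if "m \<ge> K + nat (1 - n)" for m
      using that n by simp
    then show ?thesis by blast
  qed
  show False
  proof (rule parallel_descents[of "\<lambda>k. x (- int k)" "\<lambda>k. x (1 - int k)" "\<lambda>j. x (1 + 0 + int j)"])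
    show "\<exists>K. \<forall>m\<ge>K. le (x (- int m)) (x (- int k)) \<and> le (x (- int m)) (x (1 - int k)) \<and>
      le (x (1 - int m)) (x (- int k)) \<and> le (x (1 - int m)) (x (1 - int k))" for k
      using ev[of "- int k"] ev[of "1 - int k"] by simp (meson le_trans nat_le_linear)
    show "\<not> le (x (- int i)) (x (1 - int i))" for i
      using late[of "- int i"] by simp
    show "\<not> le (x (1 - int i)) (x (- int i))" for i
      by (intro nodown) simp
    show "\<exists>K. \<forall>k\<ge>K. le (x (- int k)) (x (1 + 0 + int 0)) \<and> le (x (1 - int k)) (x (1 + 0 + int 0))"
      using ev[of 1] by simp
  qed (use P chain[of 0] in auto)
qed

text \<open>
  If moving forward by one index created a relation between \<open>x i\<close> and \<open>x j\<close>, then the progression with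
  difference \<open>\<bar>j - i\<bar>\<close> through these two indices would have the shape excluded above, in the given order
  or in its dual according to the sign of \<open>j - i\<close>.
\<close>

lemma orbit_stable:
  fixes x :: "int \<Rightarrow> 'a"
  assumes P: "\<And>i. x i \<in> P" and inj: "inj x" and sh: "shifts le x x"
  shows "le (x (i + k)) (x (j + k)) \<longleftrightarrow> le (x i) (x j)"
proof -
  have mono: "le (x (i + l)) (x (j + l))" if "le (x (i + k)) (x (j + k))" "k \<le> l" for i j k l
    using shiftsD[OF sh that(1), of "l - k"] that(2) by simp
  have step: "le (x i) (x j)" if le: "le (x (i + 1)) (x (j + 1))" for i j
  proof (rule ccontr)
    assume nle: "\<not> le (x i) (x j)"
    have thr: "le (x (i + n)) (x (j + n)) \<longleftrightarrow> 1 \<le> n" for n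
      using mono[OF le, of n] mono[of i n j 0] nle by (cases "1 \<le> n") auto
    consider "i < j" | "j < i" | "i = j" by linarith
    then show False
    proof cases
      case 1
      define N where "N = j - i"
      have N: "N > 0" "j = i + N" using 1 by (simp_all add: N_def)
      show False
      proof (rule no_late_ascent[of "\<lambda>n. x (i + N * n)"])
        show "inj (\<lambda>n. x (i + N * n))"
          using inj N by (auto intro!: injI dest: injD)
        show "shifts le (\<lambda>n. x (i + N * n)) (\<lambda>n. x (i + N * n))"
          using shifts_power[OF sh] N by simp
        show "le (x (i + N * n)) (x (i + N * (n + 1))) \<longleftrightarrow> 1 \<le> n" for n
          using thr[of "N * n"] one_le_mult_iff[OF N(1)] by (simp add: N(2) distrib_left ac_simps)
      qed (use P in auto)
    next
      case 2
      define N where "N = i - j"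
      have N: "N > 0" "i = j + N" using 2 by (simp_all add: N_def)
      interpret dual: copy_free P "le\<inverse>\<inverse>"
        by (rule copy_free_dual) (rule copy_free_axioms)
      show False
      proof (rule dual.no_late_ascent[of "\<lambda>n. x (j + N * n)"])
        show "inj (\<lambda>n. x (j + N * n))"
          using inj N by (auto intro!: injI dest: injD)
        show "shifts le\<inverse>\<inverse> (\<lambda>n. x (j + N * n)) (\<lambda>n. x (j + N * n))"
          using shifts_power[OF sh] N by (simp add: shifts_dual)
        show "le\<inverse>\<inverse> (x (j + N * n)) (x (j + N * (n + 1))) \<longleftrightarrow> 1 \<le> n" for n
          using thr[of "N * n"] one_le_mult_iff[OF N(1)] by (simp add: N(2) distrib_left ac_simps)
      qed (use P in auto)
    next
      case 3
      then show False using nle refl P by simp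
    qed
  qed
  have down: "le (x i) (x j)" if "le (x (i + int m)) (x (j + int m))" for i j m
    using that
  proof (induction m)
    case (Suc m)
    then show ?case using step[of "i + int m" "j + int m"] by (simp add: ac_simps)
  qed simp
  show ?thesis
  proof (cases "k \<ge> 0")
    case True
    then show ?thesis
      using down[of i "nat k" j] mono[of i 0 j k] by auto
  next
    case False
    then show ?thesis
      using down[of "i + k" "nat (- k)" "j + k"] mono[of i k j 0] by auto
  qed
qed

lemma orbit_chain:
  fixes x :: "int \<Rightarrow> 'a"
  assumes P: "\<And>i. x i \<in> P" and inj: "inj x"
    and stable: "\<And>i j k. le (x (i + k)) (x (j + k)) \<longleftrightarrow> le (x i) (x j)"
    and step: "le (x 0) (x k)" and k: "k > 0"
  shows "le (x (i + k * a)) (x (i + k * b)) \<longleftrightarrow> a \<le> b"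
proof -
  have step': "le (x j) (x (j + k))" for j
    using stable[of 0 j k] step by (simp add: add.commute)
  have up: "le (x (i + k * a)) (x (i + k * b))" if "a \<le> b" for a b
    using that
  proof (induction b rule: int_ge_induct)
    case base
    show ?case using refl P .
  next
    case (step b)
    show ?case
      using trans[OF step.IH step'] P by (simp add: distrib_left add.assoc)
  qed
  have "i + k * a = i + k * b" if "le (x (i + k * a)) (x (i + k * b))" "b < a"
    using antisym[OF that(1) up] that(2) P inj by (simp add: inj_eq)
  then show ?thesis
    using up k by (metis add_left_cancel linorder_not_le mult_left_cancel order_less_irrefl)
qed

text \<open>
  A single relation between \<open>x 0\<close> and \<open>x k\<close> makes the progression with difference \<open>\<bar>k\<bar>\<close> a chain. The
  statement allows multiples of the difference because two orbits need a common one.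
\<close>

lemma orbit_types:
  fixes x :: "int \<Rightarrow> 'a"
  assumes P: "\<And>i. x i \<in> P" and inj: "inj x" and sh: "shifts le x x"
  obtains N :: int where "N > 0"
    "(\<forall>M>0. \<forall>i j. le (x (N * M * i)) (x (N * M * j)) \<longleftrightarrow> i = j) \<or>
     (\<forall>M>0. \<forall>i j. le (x (N * M * i)) (x (N * M * j)) \<longleftrightarrow> i \<le> j) \<or>
     (\<forall>M>0. \<forall>i j. le (x (N * M * i)) (x (N * M * j)) \<longleftrightarrow> j \<le> i)"
proof (cases "\<exists>k. k \<noteq> 0 \<and> le (x 0) (x k)")
  case False
  have "le (x i) (x j) \<longleftrightarrow> i = j" for i j
  proof (cases "i = j")
    case ne: False
    then have "j - i \<noteq> 0" by simp
    then have "\<not> le (x 0) (x (j - i))"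
      using False by blast
    then show ?thesis
      using ne orbit_stable[OF P inj sh, of 0 i "j - i"] by simp
  qed (use refl P in simp)
  then show thesis
    by (intro that[of 1]) auto
next
  case True
  then obtain k where k: "k \<noteq> 0" "le (x 0) (x k)" by blast
  note stable = orbit_stable[OF P inj sh]
  show thesis
  proof (cases "k > 0")
    case True
    have "le (x (k * M * i)) (x (k * M * j)) \<longleftrightarrow> i \<le> j" if "M > 0" for M i j
      using orbit_chain[OF P inj stable k(2) True, of 0 "M * i" "M * j"] that
      by (simp add: mult.assoc)
    then show thesis
      by (intro that[of k]) (use True in auto)
  next
    case False
    interpret dual: copy_free P "le\<inverse>\<inverse>"
      by (rule copy_free_dual) (rule copy_free_axioms)
    have k': "le\<inverse>\<inverse> (x 0) (x (- k))" "- k > 0"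
      using k False stable[of 0 "- k" k] by auto
    have "le (x (- k * M * i)) (x (- k * M * j)) \<longleftrightarrow> j \<le> i" if "M > 0" for M i j
      using dual.orbit_chain[OF P inj _ k', of 0 "M * j" "M * i"] stable that
      by (simp add: mult.assoc)
    then show thesis
      by (intro that[of "- k"]) (use k' in auto)
  qed
qed

lemma orbit_over_point:
  fixes y :: "int \<Rightarrow> 'a"
  assumes P: "p \<in> P" "\<And>i. y i \<in> P" and inj: "inj y" and sh: "shifts le y y"
    and late: "\<And>n. le p (y n) \<longleftrightarrow> 1 \<le> n" and yp: "\<And>n. \<not> le (y n) p"
  shows False
proof -
  obtain N where N: "N > 0"
    "(\<forall>M>0. \<forall>i j. le (y (N * M * i)) (y (N * M * j)) \<longleftrightarrow> i = j) \<or>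
     (\<forall>M>0. \<forall>i j. le (y (N * M * i)) (y (N * M * j)) \<longleftrightarrow> i \<le> j) \<or>
     (\<forall>M>0. \<forall>i j. le (y (N * M * i)) (y (N * M * j)) \<longleftrightarrow> j \<le> i)"
    using orbit_types[OF P(2) inj sh] by blast
  define z where "z n = y (N * n)" for n
  have z: "(\<forall>i j. le (z i) (z j) \<longleftrightarrow> i = j) \<or> (\<forall>i j. le (z i) (z j) \<longleftrightarrow> i \<le> j) \<or>
      (\<forall>i j. le (z i) (z j) \<longleftrightarrow> j \<le> i)"
    using N(2) by (elim disjE) (auto simp: z_def dest: spec[of _ 1])
  have zP: "z i \<in> P" and zp: "\<not> le (z i) p" for i
    using P yp by (simp_all add: z_def)
  have late: "le p (z n) \<longleftrightarrow> 1 \<le> n" for n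
    using late one_le_mult_iff[OF N(1)] by (simp add: z_def)
  show False
    using z
  proof (elim disjE)
    assume z: "\<forall>i j. le (z i) (z j) \<longleftrightarrow> i = j"
    have "{i. le p (z i)} = {1..}" "{i. \<not> le p (z i)} = {..<1}"
      using late by auto
    then show False
      using antichain_split_below[of p z] P zP zp z
      by (simp add: infinite_Ici infinite_Iio)
  next
    assume z: "\<forall>i j. le (z i) (z j) \<longleftrightarrow> i \<le> j"
    show False
      by (rule no_F5[of p "\<lambda>i. z (- int i)" "\<lambda>i. z (1 + int i)"])
        (use P zP zp z late in auto)
  next
    assume z: "\<forall>i j. le (z i) (z j) \<longleftrightarrow> j \<le> i"
    show False
      using trans[of p "z 1" "z 0"] z late[of 1] late[of 0] P zP by simp
  qed
qed

end

section \<open>Two orbits\<close>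

text \<open>
  A relation with finite rows and columns vanishes between different blocks of a suitable sequence.
  Each block has a nonpositive and a positive index, because \<open>x\<^sub>n\<close> and \<open>y\<^sub>n\<close> are unrelated for
  \<open>n \<le> 0\<close> and related for \<open>n \<ge> 1\<close>, and the copies of \<open>F\<^sub>3\<close> and \<open>F\<^sub>8\<close> draw on both kinds.
\<close>

lemma spread_sparse:
  fixes G :: "int \<Rightarrow> int \<Rightarrow> bool"
  assumes row: "\<And>p. finite {q. G p q}" and col: "\<And>q. finite {p. G p q}"
  shows "\<exists>r :: nat \<Rightarrow> nat. strict_mono r \<and>
    (\<forall>i j. i \<noteq> j \<longrightarrow> (\<forall>p\<in>{- int (r i), 1 + int (r i)}. \<forall>q\<in>{- int (r j), 1 + int (r j)}. \<not> G p q))"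
proof -
  let ?e = "\<lambda>n::nat. {- int n, 1 + int n}"
  let ?R = "\<lambda>k m. \<forall>p\<in>?e k. \<forall>q\<in>?e m. \<not> G p q \<and> \<not> G q p"
  have "\<exists>K. \<forall>m\<ge>K. ?R k m" for k
  proof -
    let ?A = "\<Union>p\<in>?e k. {q. G p q} \<union> {q. G q p}"
    have "finite ?A" using row col by blast
    from finite_int_bounded[OF this] obtain B where B: "\<forall>q\<in>?A. \<bar>q\<bar> < B" ..
    have "q \<notin> ?A" if "m \<ge> nat B" "q \<in> ?e m" for m q
    proof
      assume "q \<in> ?A"
      with B have "\<bar>q\<bar> < B" by (rule bspec)
      then show False using that by auto
    qed
    then show ?thesis by (intro exI[of _ "nat B"]) blast
  qed
  from thin_sequence[of ?R, OF this] obtain r :: "nat \<Rightarrow> nat"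
    where r: "strict_mono r" "\<forall>i j. i < j \<longrightarrow> ?R (r i) (r j)" by (elim exE conjE)
  have "\<not> G p q" if "i \<noteq> j" "p \<in> ?e (r i)" "q \<in> ?e (r j)" for i j p q
    using r(2) that by (cases i j rule: linorder_cases) blast+
  then show ?thesis
    using r(1) by blast
qed

context copy_free
begin

text \<open>
  If some \<open>x n\<close> with \<open>n \<le> 0\<close> is above no earlier element of the other chain, it forms \<open>F\<^sub>5\<close> with that
  chain, and symmetrically. Otherwise the two chains descend in parallel and yield \<open>F\<^sub>6\<close>.
\<close>

lemma increasing_increasing:
  fixes x y :: "int \<Rightarrow> 'a"
  assumes P: "\<And>i. x i \<in> P" "\<And>i. y i \<in> P"
    and x: "\<And>i j. le (x i) (x j) \<longleftrightarrow> i \<le> j" and y: "\<And>i j. le (y i) (y j) \<longleftrightarrow> i \<le> j"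
    and late: "\<And>n. le (x n) (y n) \<longleftrightarrow> 1 \<le> n" and yx: "\<And>n. \<not> le (y n) (x n)"
  shows False
proof -
  have top: "le (x n) (y 1)" "le (y n) (y 1)" if "n \<le> 0" for n
    using trans[of "x n" "x 1" "y 1"] x y late[of 1] P that by simp_all
  have xy: "\<not> le (x n) (y m)" if "n \<le> 0" "m \<le> n" for n m
    using trans[of "x n" "y m" "y n"] y late P that by fastforce
  have yx': "\<not> le (y n) (x m)" if "m \<le> n" for n m
    using trans[of "y n" "x m" "x n"] x yx P that by blast
  have below_x: "\<exists>m\<le>n. le (y m) (x n)" if n: "n \<le> 0" for n
  proof (rule ccontr)
    assume none: "\<not> ?thesis"
    show False
      by (rule no_F5[of "x n" "\<lambda>i. y (n - int i)" "\<lambda>j. y (1 + int j)"])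
        (use P y xy[OF n] none top n in auto)
  qed
  have below_y: "\<exists>m\<le>n. le (x m) (y n)" if n: "n \<le> 0" for n
  proof (rule ccontr)
    assume none: "\<not> ?thesis"
    show False
      by (rule no_F5[of "y n" "\<lambda>i. x (n - int i)" "\<lambda>j. y (1 + int j)"])
        (use P x y yx' none top n in auto)
  qed
  show False
  proof (rule parallel_descents[of "\<lambda>k. x (- int k)" "\<lambda>k. y (- int k)" "\<lambda>j. y (1 + int j)"])
    fix k
    obtain m1 where m1: "m1 \<le> - int k" "le (y m1) (x (- int k))"
      using below_x[of "- int k"] by auto
    obtain m2 where m2: "m2 \<le> - int k" "le (x m2) (y (- int k))"
      using below_y[of "- int k"] by auto
    have "le (x (- int m)) (x (- int k)) \<and> le (x (- int m)) (y (- int k)) \<and>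
        le (y (- int m)) (x (- int k)) \<and> le (y (- int m)) (y (- int k))"
      if "m \<ge> nat (- m1) + nat (- m2)" for m
      using trans[OF _ m1(2), of "y (- int m)"] trans[OF _ m2(2), of "x (- int m)"]
        x y P m1(1) m2(1) that by simp
    then show "\<exists>K. \<forall>m\<ge>K. le (x (- int m)) (x (- int k)) \<and> le (x (- int m)) (y (- int k)) \<and>
        le (y (- int m)) (x (- int k)) \<and> le (y (- int m)) (y (- int k))" by blast
  qed (use P y late yx top in auto)
qed

lemma increasing_decreasing:
  fixes x y :: "int \<Rightarrow> 'a"
  assumes P: "\<And>i. x i \<in> P" "\<And>i. y i \<in> P"
    and x: "\<And>i j. le (x i) (x j) \<longleftrightarrow> i \<le> j" and y: "\<And>i j. le (y i) (y j) \<longleftrightarrow> j \<le> i"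
    and late: "\<And>n. le (x n) (y n) \<longleftrightarrow> 1 \<le> n"
  shows False
  using trans[of "x 0" "x 1" "y 1"] trans[of "x 0" "y 1" "y 0"] x y late[of 1] late[of 0] P
  by simp

text \<open>
  Whether \<open>x 0\<close> lies below some element of the other chain decides between \<open>F\<^sub>5\<close> and its dual.
\<close>

lemma decreasing_increasing:
  fixes x y :: "int \<Rightarrow> 'a"
  assumes P: "\<And>i. x i \<in> P" "\<And>i. y i \<in> P"
    and x: "\<And>i j. le (x i) (x j) \<longleftrightarrow> j \<le> i" and y: "\<And>i j. le (y i) (y j) \<longleftrightarrow> i \<le> j"
    and late: "\<And>n. le (x n) (y n) \<longleftrightarrow> 1 \<le> n" and yx: "\<And>i j. \<not> le (y i) (x j)"
  shows False
proof (cases "\<exists>J. le (x 0) (y J)")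
  case True
  then obtain J where J: "le (x 0) (y J)" by blast
  have neg: "\<not> le (x 0) (y j)" if "j \<le> 0" for j
    using trans[of "x 0" "y j" "y 0"] y late[of 0] P that by auto
  have "J > 0" using J neg[of J] by linarith
  then show False
    using no_F5[of "x 0" "\<lambda>i. y (- int i)" "\<lambda>j. y (J + int j)"] P y yx neg J by simp
next
  case False
  interpret dual: copy_free P "le\<inverse>\<inverse>"
    by (rule copy_free_dual) (rule copy_free_axioms)
  show False
    by (rule dual.no_F5[of "x 0" "\<lambda>i. y (1 + int i)" "\<lambda>j. x (1 + int j)"])
      (use P x y yx False late in auto)
qed

lemma antichain_increasing:
  fixes x y :: "int \<Rightarrow> 'a"
  assumes P: "\<And>i. x i \<in> P" "\<And>i. y i \<in> P"
    and x: "\<And>i j. le (x i) (x j) \<longleftrightarrow> i = j" and y: "\<And>i j. le (y i) (y j) \<longleftrightarrow> i \<le> j"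
    and yx: "\<And>i j. \<not> le (y i) (x j)"
  shows False
  by (rule antichain_below_chain[of "\<lambda>i. x (int i)" "\<lambda>i. y (int i)"]) (use P x y yx in auto)

text \<open>
  All \<open>x m\<close> with \<open>m \<ge> 1\<close> are below \<open>y 0\<close>, and no other is, because \<open>x m \<le> y 0 \<le> y m\<close> is impossible
  for \<open>m \<le> 0\<close>. This is the dual of \<open>F\<^sub>2\<close>.
\<close>

lemma antichain_decreasing:
  fixes x y :: "int \<Rightarrow> 'a"
  assumes P: "\<And>i. x i \<in> P" "\<And>i. y i \<in> P"
    and x: "\<And>i j. le (x i) (x j) \<longleftrightarrow> i = j" and y: "\<And>i j. le (y i) (y j) \<longleftrightarrow> j \<le> i"
    and late: "\<And>n. le (x n) (y n) \<longleftrightarrow> 1 \<le> n" and yx: "\<And>i j. \<not> le (y i) (x j)"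
  shows False
proof -
  interpret dual: copy_free P "le\<inverse>\<inverse>"
    by (rule copy_free_dual) (rule copy_free_axioms)
  have pos: "le (x m) (y 0)" if "1 \<le> m" for m
    using trans[of "x m" "y m" "y 0"] y late[of m] P that by simp
  have neg: "\<not> le (x m) (y 0)" if "m \<le> 0" for m
    using trans[of "x m" "y 0" "y m"] y late[of m] P that by auto
  have "{m. le (x m) (y 0)} = {1..}" "{m. \<not> le (x m) (y 0)} = {..0}"
    using pos neg by (auto simp: not_less) (metis int_one_le_iff_zero_less not_less)+
  then show False
    using dual.antichain_split_below[of "y 0" x] P x yx
    by (auto simp: infinite_Ici infinite_Iic)
qed

text \<open>
  Relations between the two antichains are classified by rows and columns, each of which is finite or
  cofinite. If the row of \<open>i\<close> is finite and the column of \<open>j\<close> is cofinite, then for large \<open>k\<close> the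
  relation at \<open>(j - k, j)\<close>, shifted forward to \<open>(i, i + k)\<close>, contradicts the finiteness of the row; the
  opposite mixture is excluded in the same way. So all rows and columns are of the same kind.
\<close>

lemma antichain_antichain:
  fixes x y :: "int \<Rightarrow> 'a"
  assumes P: "\<And>i. x i \<in> P" "\<And>i. y i \<in> P"
    and x: "\<And>i j. le (x i) (x j) \<longleftrightarrow> i = j" and y: "\<And>i j. le (y i) (y j) \<longleftrightarrow> i = j"
    and late: "\<And>n. le (x n) (y n) \<longleftrightarrow> 1 \<le> n" and yx: "\<And>i j. \<not> le (y i) (x j)"
    and sh: "shifts le x y"
  shows False
proof -
  interpret dual: copy_free P "le\<inverse>\<inverse>"
    by (rule copy_free_dual) (rule copy_free_axioms)
  define G where "G i j = le (x i) (y j)" for i j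
  have row: "finite {j. G i j} \<or> finite {j. \<not> G i j}" for i
    using antichain_split_below[of "x i" y] P y yx unfolding G_def by blast
  have col: "finite {i. G i j} \<or> finite {i. \<not> G i j}" for j
    using dual.antichain_split_below[of "y j" x] P x yx unfolding G_def by auto
  have G_shift: "G i' j'" if "G i j" "i \<le> i'" "i' - i = j' - j" for i j i' j'
  proof -
    have eq: "i + (i' - i) = i'" "j + (i' - i) = j'" using that by linarith+
    show ?thesis
      using shiftsD[OF sh, of i j "i' - i", unfolded eq] that unfolding G_def by simp
  qed
  have fin: "finite {i. G i j}" if "finite {j. G i j}" for i j
  proof (rule ccontr)
    assume "infinite {i. G i j}"
    then have "finite ({j. G i j} \<union> {i. \<not> G i j})"
      using that col by blast
    from finite_int_bounded[OF this] obtain B where B: "\<And>q. G i q \<Longrightarrow> \<bar>q\<bar> < B" "\<And>p. \<not> G p j \<Longrightarrow> \<bar>p\<bar> < B"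
      by blast
    define k where "k = \<bar>i\<bar> + \<bar>j\<bar> + \<bar>B\<bar>"
    have "G (j - k) j" using B(2)[of "j - k"] by (force simp: k_def)
    then have "G i (i + k)" by (rule G_shift) (auto simp: k_def)
    then show False using B(1)[of "i + k"] by (simp add: k_def)
  qed
  have cofin: "finite {i. \<not> G i j}" if "finite {j. \<not> G i j}" for i j
  proof (rule ccontr)
    assume "infinite {i. \<not> G i j}"
    then have "finite ({j. \<not> G i j} \<union> {i. G i j})"
      using that col by blast
    from finite_int_bounded[OF this] obtain B where B: "\<And>q. \<not> G i q \<Longrightarrow> \<bar>q\<bar> < B" "\<And>p. G p j \<Longrightarrow> \<bar>p\<bar> < B"
      by blast
    define k where "k = \<bar>i\<bar> + \<bar>j\<bar> + \<bar>B\<bar>"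
    have "G i (i - k)" using B(1)[of "i - k"] by (force simp: k_def)
    then have "G (j + k) j" by (rule G_shift) (auto simp: k_def)
    then show False using B(2)[of "j + k"] by (simp add: k_def)
  qed
  show False
  proof (cases "finite {j. G 0 j}")
    case True
    have fin_col: "finite {i. G i j}" for j
      using fin True by blast
    have fin_row: "finite {j. G i j}" for i
    proof (rule ccontr)
      assume "infinite {j. G i j}"
      then have "finite {i. \<not> G i 0}" using row cofin by blast
      then have "finite ({i. \<not> G i 0} \<union> {i. G i 0})" using fin_col by blast
      moreover have "{i. \<not> G i 0} \<union> {i. G i 0} = (UNIV :: int set)" by blast
      ultimately show False using infinite_UNIV_int by simp
    qed
    from spread_sparse[of G, OF fin_row fin_col]
    obtain r :: "nat \<Rightarrow> nat" where r: "strict_mono r"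
      "\<forall>i j. i \<noteq> j \<longrightarrow> (\<forall>p\<in>{- int (r i), 1 + int (r i)}. \<forall>q\<in>{- int (r j), 1 + int (r j)}. \<not> G p q)"
      unfolding not_not by (elim exE conjE)
    note r_eq = strict_mono_eq[OF r(1)]
    \<comment> \<open>The isolated points and the related pairs are taken from different blocks, because inside a
      block nothing is known about relations between indices of different sign.\<close>
    have odd_even: "2 * i \<noteq> Suc (2 * j)" for i j :: nat by presburger
    show False
    proof (rule no_F3[of "\<lambda>i. x (- int (r (2 * i)))" "\<lambda>i. x (1 + int (r (2 * i + 1)))"
          "\<lambda>i. y (1 + int (r (2 * i + 1)))"])
      fix i j
      show "le (x (1 + int (r (2 * i + 1)))) (y (1 + int (r (2 * j + 1)))) \<longleftrightarrow> i = j"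
        using r(2)[rule_format, of "2 * i + 1" "2 * j + 1"] late by (auto simp: G_def)
      show "\<not> le (x (- int (r (2 * i)))) (y (1 + int (r (2 * j + 1))))"
        using r(2)[rule_format, of "2 * i" "2 * j + 1"] odd_even by (auto simp: G_def)
    qed (use P x y yx r_eq odd_even in auto)
  next
    case False
    then have "finite {j. \<not> G 0 j}" using row by blast
    then have cofin_col: "finite {i. \<not> G i j}" for j
      using cofin by blast
    have cofin_row: "finite {j. \<not> G i j}" for i
    proof (rule ccontr)
      assume "infinite {j. \<not> G i j}"
      then have "finite {i. G i 0}" using row fin by blast
      then have "finite ({i. \<not> G i 0} \<union> {i. G i 0})" using cofin_col by blast
      moreover have "{i. \<not> G i 0} \<union> {i. G i 0} = (UNIV :: int set)" by blast
      ultimately show False using infinite_UNIV_int by simp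
    qed
    from spread_sparse[of "\<lambda>p q. \<not> G p q", OF cofin_row cofin_col]
    obtain r :: "nat \<Rightarrow> nat" where r: "strict_mono r"
      "\<forall>i j. i \<noteq> j \<longrightarrow> (\<forall>p\<in>{- int (r i), 1 + int (r i)}. \<forall>q\<in>{- int (r j), 1 + int (r j)}. G p q)"
      unfolding not_not by (elim exE conjE)
    \<comment> \<open>The encoding of \<open>\<int>\<close> assigns a block to each index of \<open>F\<^sub>8\<close>, whose sign then selects the
      related or the unrelated pair of the block.\<close>
    define s where
      "s i = (if i > 0 then 1 + int (r (int_encode i)) else - int (r (int_encode i)))" for i
    have s: "s i \<in> {- int (r (int_encode i)), 1 + int (r (int_encode i))}" "1 \<le> s i \<longleftrightarrow> i > 0" for i
      by (auto simp: s_def)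
    have G: "G (s i) (s j)" if "i \<noteq> j" for i j
      by (rule r(2)[rule_format, OF _ s(1) s(1)]) (simp add: that int_encode_eq)
    have s_eq: "s i = s j \<longleftrightarrow> i = j" for i j
      using strict_mono_eq[OF r(1)] by (auto simp: s_def int_encode_eq split: if_splits)
    have "le (x (s i)) (y (s j)) \<longleftrightarrow> i > 0 \<or> j \<noteq> i" for i j
      using G[of i j] late[of "s i"] s(2)[of i] by (cases "i = j") (auto simp: G_def)
    then show False
      by (intro no_F8[of "\<lambda>i. x (s i)" "\<lambda>i. y (s i)"]) (use P x y yx s_eq in auto)
  qed
qed

text \<open>
  A relation \<open>y i \<le> x j\<close>, shifted far forward, is enclosed by \<open>x (i + k) \<le> y (i + k)\<close> and
  \<open>x (j + k) \<le> y (j + k)\<close>. It therefore forces relations within both orbits, which most combinations of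
  types rule out unless \<open>i = j\<close>. The combinations not treated by a lemma of their own are the
  duals, with the two orbits exchanged, of combinations that are.
\<close>

lemma typed_orbits:
  fixes x y :: "int \<Rightarrow> 'a"
  assumes P: "\<And>i. x i \<in> P" "\<And>i. y i \<in> P" and ne: "\<And>i j. x i \<noteq> y j"
    and sh: "shifts le x y" "shifts le y x" and late: "\<And>n. le (x n) (y n) \<longleftrightarrow> 1 \<le> n"
    and x: "(\<forall>i j. le (x i) (x j) \<longleftrightarrow> i = j) \<or> (\<forall>i j. le (x i) (x j) \<longleftrightarrow> i \<le> j) \<or>
      (\<forall>i j. le (x i) (x j) \<longleftrightarrow> j \<le> i)"
    and y: "(\<forall>i j. le (y i) (y j) \<longleftrightarrow> i = j) \<or> (\<forall>i j. le (y i) (y j) \<longleftrightarrow> i \<le> j) \<or>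
      (\<forall>i j. le (y i) (y j) \<longleftrightarrow> j \<le> i)"
  shows False
proof -
  interpret dual: copy_free P "le\<inverse>\<inverse>"
    by (rule copy_free_dual) (rule copy_free_axioms)
  have transfer: "\<exists>k. le (x (i + k)) (x (j + k)) \<and> le (y (i + k)) (y (j + k))"
    if "le (y i) (x j)" for i j
  proof -
    define k where "k = \<bar>i\<bar> + \<bar>j\<bar> + 1"
    have "le (y (i + k)) (x (j + k))"
      using shiftsD[OF sh(2) that] by (simp add: k_def)
    moreover have "le (x (i + k)) (y (i + k))" "le (x (j + k)) (y (j + k))"
      using late by (simp_all add: k_def)
    ultimately show ?thesis
      using trans P by blast
  qed
  have diag: "\<not> le (y n) (x n)" for n
  proof
    assume "le (y n) (x n)"
    define m where "m = \<bar>n\<bar> + 1"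
    have "le (y m) (x m)" "le (x m) (y m)"
      using shiftsD[OF sh(2) \<open>le (y n) (x n)\<close>, of "m - n"] late[of m] by (simp_all add: m_def)
    then show False
      using antisym P ne by metis
  qed
  have yx: "\<not> le (y i) (x j)"
    if "\<And>k. le (x (i + k)) (x (j + k)) \<Longrightarrow> le (y (i + k)) (y (j + k)) \<Longrightarrow> i = j" for i j
    using transfer[of i j] that diag by blast
  show False
    using x
  proof (elim disjE)
    assume x: "\<forall>i j. le (x i) (x j) \<longleftrightarrow> i = j"
    then have yx: "\<not> le (y i) (x j)" for i j by (intro yx) simp
    show False
      using y
    proof (elim disjE)
      assume y: "\<forall>i j. le (y i) (y j) \<longleftrightarrow> i = j"
      show False
        by (rule antichain_antichain[of x y]) (use P x y late yx sh in auto)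
    next
      assume y: "\<forall>i j. le (y i) (y j) \<longleftrightarrow> i \<le> j"
      show False
        by (rule antichain_increasing[of x y]) (use P x y yx in auto)
    next
      assume y: "\<forall>i j. le (y i) (y j) \<longleftrightarrow> j \<le> i"
      show False
        by (rule antichain_decreasing[of x y]) (use P x y late yx in auto)
    qed
  next
    assume x: "\<forall>i j. le (x i) (x j) \<longleftrightarrow> i \<le> j"
    show False
      using y
    proof (elim disjE)
      assume y: "\<forall>i j. le (y i) (y j) \<longleftrightarrow> i = j"
      then have yx: "\<not> le (y i) (x j)" for i j by (intro yx) simp
      show False
        by (rule dual.antichain_decreasing[of y x]) (use P x y late yx in auto)
    next
      assume y: "\<forall>i j. le (y i) (y j) \<longleftrightarrow> i \<le> j"
      show False
        by (rule increasing_increasing[of x y]) (use P x y late diag in auto)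
    next
      assume y: "\<forall>i j. le (y i) (y j) \<longleftrightarrow> j \<le> i"
      show False
        by (rule increasing_decreasing[of x y]) (use P x y late in auto)
    qed
  next
    assume x: "\<forall>i j. le (x i) (x j) \<longleftrightarrow> j \<le> i"
    show False
      using y
    proof (elim disjE)
      assume y: "\<forall>i j. le (y i) (y j) \<longleftrightarrow> i = j"
      then have yx: "\<not> le (y i) (x j)" for i j by (intro yx) simp
      show False
        by (rule dual.antichain_increasing[of y x]) (use P x y yx in auto)
    next
      assume y: "\<forall>i j. le (y i) (y j) \<longleftrightarrow> i \<le> j"
      have yx: "\<not> le (y i) (x j)" for i j using x y by (intro yx) simp
      show False
        by (rule decreasing_increasing[of x y]) (use P x y late yx in auto)
    next
      assume y: "\<forall>i j. le (y i) (y j) \<longleftrightarrow> j \<le> i"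
      show False
        by (rule dual.increasing_increasing[of y x]) (use P x y late diag in auto)
    qed
  qed
qed

lemma two_orbits:
  fixes x y :: "int \<Rightarrow> 'a"
  assumes P: "\<And>i. x i \<in> P" "\<And>i. y i \<in> P" and inj: "inj x" "inj y" and ne: "\<And>i j. x i \<noteq> y j"
    and sh: "shifts le x x" "shifts le y y" "shifts le x y" "shifts le y x"
    and late: "\<And>n. le (x n) (y n) \<longleftrightarrow> 1 \<le> n"
  shows False
proof -
  obtain M where M: "M > 0"
    "(\<forall>K>0. \<forall>i j. le (x (M * K * i)) (x (M * K * j)) \<longleftrightarrow> i = j) \<or>
     (\<forall>K>0. \<forall>i j. le (x (M * K * i)) (x (M * K * j)) \<longleftrightarrow> i \<le> j) \<or>
     (\<forall>K>0. \<forall>i j. le (x (M * K * i)) (x (M * K * j)) \<longleftrightarrow> j \<le> i)"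
    using orbit_types[OF P(1) inj(1) sh(1)] by blast
  obtain N where N: "N > 0"
    "(\<forall>K>0. \<forall>i j. le (y (N * K * i)) (y (N * K * j)) \<longleftrightarrow> i = j) \<or>
     (\<forall>K>0. \<forall>i j. le (y (N * K * i)) (y (N * K * j)) \<longleftrightarrow> i \<le> j) \<or>
     (\<forall>K>0. \<forall>i j. le (y (N * K * i)) (y (N * K * j)) \<longleftrightarrow> j \<le> i)"
    using orbit_types[OF P(2) inj(2) sh(2)] by blast
  have MN: "M * N > 0" using M(1) N(1) by simp
  show False
  proof (rule typed_orbits[of "\<lambda>n. x (M * N * n)" "\<lambda>n. y (M * N * n)"])
    show "shifts le (\<lambda>n. x (M * N * n)) (\<lambda>n. y (M * N * n))"
      using shifts_power[OF sh(3), of "M * N" 0 0] MN by simp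
    show "shifts le (\<lambda>n. y (M * N * n)) (\<lambda>n. x (M * N * n))"
      using shifts_power[OF sh(4), of "M * N" 0 0] MN by simp
    show "le (x (M * N * n)) (y (M * N * n)) \<longleftrightarrow> 1 \<le> n" for n
      using late one_le_mult_iff[OF MN] by simp
    show "(\<forall>i j. le (x (M * N * i)) (x (M * N * j)) \<longleftrightarrow> i = j) \<or>
      (\<forall>i j. le (x (M * N * i)) (x (M * N * j)) \<longleftrightarrow> i \<le> j) \<or>
      (\<forall>i j. le (x (M * N * i)) (x (M * N * j)) \<longleftrightarrow> j \<le> i)"
      using M(2) N(1) by blast
    show "(\<forall>i j. le (y (M * N * i)) (y (M * N * j)) \<longleftrightarrow> i = j) \<or>
      (\<forall>i j. le (y (M * N * i)) (y (M * N * j)) \<longleftrightarrow> i \<le> j) \<or>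
      (\<forall>i j. le (y (M * N * i)) (y (M * N * j)) \<longleftrightarrow> j \<le> i)"
      unfolding mult.commute[of M N] using N(2) M(1) by blast
  qed (use P ne in auto)
qed

lemma fixed_point_and_orbit:
  fixes y :: "int \<Rightarrow> 'a"
  assumes P: "p \<in> P" "\<And>i. y i \<in> P" and inj: "inj y" and sh: "shifts le y y"
    and py: "shifts le (\<lambda>_. p) y" "shifts le y (\<lambda>_. p)" and ne: "\<And>n. y n \<noteq> p"
    and late: "\<And>n. le p (y n) \<longleftrightarrow> 1 \<le> n"
  shows False
proof (rule orbit_over_point[of p y])
  show "\<not> le (y n) p" for n
  proof
    assume "le (y n) p"
    then have "le (y (\<bar>n\<bar> + 1)) p"
      using shiftsD[OF py(2) \<open>le (y n) p\<close>, of "\<bar>n\<bar> + 1 - n"] by simp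
    then show False
      using antisym[of "y (\<bar>n\<bar> + 1)" p] late P ne by simp
  qed
qed (use assms in auto)

end

section \<open>Orbits of a bijection\<close>

definition orbit :: "('a \<Rightarrow> 'a) \<Rightarrow> 'a set \<Rightarrow> (int \<Rightarrow> 'a) \<Rightarrow> bool" where
  "orbit f A u \<longleftrightarrow> (\<forall>n. u n \<in> A \<and> u (n + 1) = f (u n))"

lemma orbitD:
  assumes "orbit f A u"
  shows "u n \<in> A" "u (n + 1) = f (u n)"
  using assms unfolding orbit_def by blast+

lemma orbit_through:
  assumes bij: "bij_betw f A A" and a: "a \<in> A"
  shows "\<exists>u. orbit f A u \<and> u 0 = a"
proof -
  define g where "g = inv_into A f"
  have g: "g b \<in> A" "f (g b) = b" if "b \<in> A" for b
    using bij_betw_inv_into_right[OF bij that] bij_betw_apply[OF bij_betw_inv_into[OF bij] that]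
    by (simp_all add: g_def)
  define u where "u n = (if n \<ge> 0 then (f ^^ nat n) a else (g ^^ nat (- n)) a)" for n :: int
  have fA: "(f ^^ m) a \<in> A" and gA: "(g ^^ m) a \<in> A" for m
    by (induction m) (use a g(1) bij_betw_apply[OF bij] in auto)
  have "u (n + 1) = f (u n)" for n
  proof (cases "n \<ge> 0")
    case True
    then show ?thesis by (simp add: u_def nat_add_distrib)
  next
    case False
    then obtain m where n: "n = - int (Suc m)"
      using negD[of n] by auto
    show ?thesis
      using g(2)[OF gA[of m]] by (cases m) (simp_all add: u_def n nat_add_distrib)
  qed
  moreover have "u n \<in> A" for n
    using fA gA by (simp add: u_def)
  moreover have "u 0 = a"
    by (simp add: u_def)
  ultimately show ?thesis
    unfolding orbit_def by blast
qed

lemma orbits_meet: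
  assumes f: "inj_on f A" and u: "orbit f A u" and v: "orbit f A v" and eq: "u i = v j"
  shows "u (i + k) = v (j + k)"
proof (induction k rule: int_induct[of _ 0])
  case base
  show ?case using eq by simp
next
  case (step1 k)
  then show ?case
    using orbitD(2)[OF u, of "i + k"] orbitD(2)[OF v, of "j + k"] by (simp add: add.assoc)
next
  case (step2 k)
  have "f (u (i + (k - 1))) = f (v (j + (k - 1)))"
    using step2 orbitD(2)[OF u, of "i + (k - 1)"] orbitD(2)[OF v, of "j + (k - 1)"]
    by (simp add: add.assoc)
  then show ?case
    using f orbitD(1)[OF u] orbitD(1)[OF v] by (meson inj_onD)
qed

lemma noninj_orbit_periodic:
  assumes f: "inj_on f A" and u: "orbit f A u" and noninj: "\<not> inj u"
  shows "\<exists>p>0. \<forall>n. u (p * n) = u 0"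
proof -
  obtain i j where ij: "u i = u j" "i < j"
    using noninj by (metis injI linorder_neqE)
  define p where "p = j - i"
  have p: "u (n + p) = u n" for n
    using orbits_meet[OF f u u ij(1), of "n - i"] by (simp add: p_def algebra_simps)
  have "u (p * n) = u 0" for n
  proof (induction n rule: int_induct[of _ 0])
    case (step1 n)
    then show ?case using p[of "p * n"] by (simp add: distrib_left)
  next
    case (step2 n)
    then show ?case using p[of "p * (n - 1)"] by (simp add: algebra_simps)
  qed simp
  moreover have "p > 0" using ij(2) by (simp add: p_def)
  ultimately show ?thesis by blast
qed

lemma orbits_shift:
  assumes mono: "monotone_on A le le f" and u: "orbit f A u" and v: "orbit f A v"
  shows "shifts le u v"
proof -
  have "le (u (i + int m)) (v (j + int m))" if "le (u i) (v j)" for i j m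
  proof (induction m)
    case (Suc m)
    have "i + int (Suc m) = i + int m + 1" "j + int (Suc m) = j + int m + 1" by simp_all
    then show ?case
      using monotone_onD[OF mono orbitD(1)[OF u] orbitD(1)[OF v] Suc]
      by (simp only: orbitD(2)[OF u] orbitD(2)[OF v])
  qed (use that in simp)
  then show ?thesis
    unfolding shifts_def by (metis nonneg_int_cases)
qed

context copy_free
begin

text \<open>
  A finite orbit becomes constant along a progression whose difference is a period; the other orbit is
  then passed to the same progression. When both orbits are infinite and meet, they are translates of
  each other, and the stability of a single orbit already applies.
\<close>

lemma no_late_pair:
  assumes f: "inj_on f P" and mono: "monotone_on P le le f"
    and x: "orbit f P x" and y: "orbit f P y"
    and now: "le (x 1) (y 1)" and before: "\<not> le (x 0) (y 0)"
  shows False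
proof -
  note shifts = orbits_shift[OF mono]
  have late: "le (x n) (y n) \<longleftrightarrow> 1 \<le> n" for n
    using shiftsD[OF shifts[OF x y] now, of "n - 1"] before
      shiftsD[OF shifts[OF x y], of n n "- n"] by (cases "1 \<le> n") auto
  have power: "shifts le (\<lambda>n. u (p * n)) (\<lambda>n. v (p * n))" if "shifts le u v" "p > 0" for u v p
    using shifts_power[OF that(1), of p 0 0] that(2) by simp
  \<comment> \<open>An infinite orbit never reaches a periodic one.\<close>
  have mixed: "u (p * n) \<noteq> v 0"
    if v: "orbit f P v" "\<forall>n. v (p * n) = v 0" "p > 0" and u: "orbit f P u" "inj u" for u v p n
  proof
    assume eq: "u (p * n) = v 0"
    have "u (p * n + p) = v (p * 1)"
      using orbits_meet[OF f u(1) v(1) eq, of p] by simp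
    also have "\<dots> = u (p * n)"
      using v(2) eq by metis
    finally show False using u(2) v(3) by (simp add: inj_eq)
  qed
  interpret dual: copy_free P "le\<inverse>\<inverse>"
    by (rule copy_free_dual) (rule copy_free_axioms)
  show False
  proof (cases "inj x"; cases "inj y")
    assume inj: "inj x" "inj y"
    have "x i \<noteq> y j" for i j
    proof
      assume "x i = y j"
      have y_eq: "y n = x (n + (i - j))" for n
        using orbits_meet[OF f x y \<open>x i = y j\<close>, of "n - j"] by (simp add: algebra_simps)
      show False
        using orbit_stable[OF orbitD(1)[OF x] inj(1) shifts[OF x x], of 0 1 "i - j"] now before
        by (simp add: y_eq add.commute)
    qed
    then show False
      using two_orbits[OF orbitD(1)[OF x] orbitD(1)[OF y] inj] shifts x y late by blast
  next
    assume inj: "\<not> inj x" "inj y"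
    from noninj_orbit_periodic[OF f x inj(1)] obtain p where p: "p > 0" "\<forall>n. x (p * n) = x 0" by blast
    show False
    proof (rule fixed_point_and_orbit[of "x 0" "\<lambda>n. y (p * n)"])
      show "inj (\<lambda>n. y (p * n))"
        using inj(2) p(1) by (auto intro!: injI dest: injD)
      show "shifts le (\<lambda>_. x 0) (\<lambda>n. y (p * n))"
        using power[OF shifts[OF x y] p(1)] p(2) by simp
      show "shifts le (\<lambda>n. y (p * n)) (\<lambda>_. x 0)"
        using power[OF shifts[OF y x] p(1)] p(2) by simp
      show "y (p * n) \<noteq> x 0" for n
        by (rule mixed) (use p inj x y in auto)
      show "le (x 0) (y (p * n)) \<longleftrightarrow> 1 \<le> n" for n
        using late[of "p * n"] one_le_mult_iff[OF p(1), of n] p(2) by simp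
    qed (use orbitD(1)[OF x] orbitD(1)[OF y] power[OF shifts[OF y y] p(1)] in auto)
  next
    assume inj: "inj x" "\<not> inj y"
    from noninj_orbit_periodic[OF f y inj(2)] obtain p where p: "p > 0" "\<forall>n. y (p * n) = y 0" by blast
    show False
    proof (rule dual.fixed_point_and_orbit[of "y 0" "\<lambda>n. x (p * n)"])
      show "inj (\<lambda>n. x (p * n))"
        using inj(1) p(1) by (auto intro!: injI dest: injD)
      show "shifts le\<inverse>\<inverse> (\<lambda>_. y 0) (\<lambda>n. x (p * n))"
        using power[OF shifts[OF x y] p(1)] p(2) by (simp add: shifts_dual)
      show "shifts le\<inverse>\<inverse> (\<lambda>n. x (p * n)) (\<lambda>_. y 0)"
        using power[OF shifts[OF y x] p(1)] p(2) by (simp add: shifts_dual)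
      show "x (p * n) \<noteq> y 0" for n
        by (rule mixed) (use p inj x y in auto)
      show "le\<inverse>\<inverse> (y 0) (x (p * n)) \<longleftrightarrow> 1 \<le> n" for n
        using late[of "p * n"] one_le_mult_iff[OF p(1), of n] p(2) by simp
    qed (use orbitD(1)[OF x] orbitD(1)[OF y] power[OF shifts[OF x x] p(1)] in
        \<open>auto simp: shifts_dual\<close>)
  next
    assume inj: "\<not> inj x" "\<not> inj y"
    obtain p where p: "p > 0" "\<forall>n. x (p * n) = x 0"
      using noninj_orbit_periodic[OF f x inj(1)] by blast
    obtain q where q: "q > 0" "\<forall>n. y (q * n) = y 0"
      using noninj_orbit_periodic[OF f y inj(2)] by blast
    have "x (p * q) = x 0" "y (p * q) = y 0"
      using p(2) q(2) by (simp_all add: mult.commute[of p])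
    then show False
      using late[of "p * q"] before p(1) q(1) by (simp add: int_one_le_iff_zero_less)
  qed
qed

lemma reversible_if_copy_free: "reversible P le"
  unfolding reversible_def
proof (intro allI impI)
  fix f
  assume "bij_betw f P P \<and> monotone_on P le le f"
  then have bij: "bij_betw f P P" and mono: "monotone_on P le le f" by auto
  show "monotone_on P le le (inv_into P f)"
  proof (rule monotone_onI, rule ccontr)
    fix a b
    assume ab: "a \<in> P" "b \<in> P" "le a b" and not: "\<not> le (inv_into P f a) (inv_into P f b)"
    note inv = bij_betw_apply[OF bij_betw_inv_into[OF bij]]
    obtain x where x: "orbit f P x" "x 0 = inv_into P f a"
      using orbit_through[OF bij inv[OF ab(1)]] by blast
    obtain y where y: "orbit f P y" "y 0 = inv_into P f b"
      using orbit_through[OF bij inv[OF ab(2)]] by blast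
    have "x 1 = a" "y 1 = b"
      using orbitD(2)[OF x(1), of 0] orbitD(2)[OF y(1), of 0] x(2) y(2) ab
        bij_betw_inv_into_right[OF bij] by simp_all
    then show False
      using no_late_pair[OF bij_betw_imp_inj_on[OF bij] mono x(1) y(1)] ab(3) not x(2) y(2) by simp
  qed
qed

end

theorem corollary2:
  fixes P :: "'a set" and le :: "'a \<Rightarrow> 'a \<Rightarrow> bool"
  assumes "poset P le"
    and "\<not> contains_copy P le F1" and "\<not> contains_copy P le F1\<inverse>\<inverse>"
    and "\<not> contains_copy P le F2" and "\<not> contains_copy P le F2\<inverse>\<inverse>"
    and "\<not> contains_copy P le F3" and "\<not> contains_copy P le F3\<inverse>\<inverse>"
    and "\<not> contains_copy P le F4" and "\<not> contains_copy P le F4\<inverse>\<inverse>"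
    and "\<not> contains_copy P le F5" and "\<not> contains_copy P le F5\<inverse>\<inverse>"
    and "\<not> contains_copy P le F6" and "\<not> contains_copy P le F6\<inverse>\<inverse>"
    and "\<not> contains_copy P le F7" and "\<not> contains_copy P le F7\<inverse>\<inverse>"
    and "\<not> contains_copy P le F8" and "\<not> contains_copy P le F8\<inverse>\<inverse>"
  shows "hereditarily_reversible P le"
proof -
  have "copy_free P le"
    using assms by unfold_locales (simp_all add: omits_def)
  then show ?thesis
    unfolding hereditarily_reversible_def
    using copy_free_subset copy_free.reversible_if_copy_free by blast
qed

end
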